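(* Let $G$ be any graph. Then the map $\tau\mapsto(\mathcal F(\tau,X))_{X\in\mathcal X}$ is a bijection from the set $\Theta'$ of $\aleph_0$-tangles of $G$ with respect to $S'$ onto the inverse limit $\mathfrak F$; that is, the $\aleph_0$-tangles of $G$ with respect to $S'$ are precisely the limits of the inverse system $\{\mathfrak F_X,\mathfrak f_{X',X}\}$.
   Context: $\mathcal X$: finite subsets of $V(G)$; $\mathcal C_X$: components of $G-X$; for $\mathcal C\subseteq\mathcal C_X$, $V[\mathcal C]$ is the vertex set of $\bigcup\mathcal C$; $\phi_{X',X}$ sends a component of $G-X'$ to the component of $G-X$ containing it; $c_X(C)$ is the principal ultrafilter on $\mathcal C_X$ of $\{C\}$. $\mathcal C_X(Y)$: components of $G-X$ with neighbourhood exactly $Y$; $\mathrm{crit}(X)=\{Y\subseteq X:\mathcal C_X(Y)\text{ infinite}\}$; $\mathcal F_X(Y)$: sets $\mathcal C\subseteq\mathcal C_X$ containing a cofinite subset of $\mathcal C_X(Y)$. $\mathfrak F_X=\{c_X(C):C\in\mathcal C_X\}\cup\{\mathcal F_X(Y):Y\in\mathrm{crit}(X)\}$; for $X\subseteq X'$: $\mathfrak f_{X',X}(c_{X'}(C'))=c_X(\phi_{X',X}(C'))$, $\mathfrak f_{X',X}(\mathcal F_{X'}(Y))=\mathcal F_X(Y)$ if $Y\subseteq X$, otherwise $c_X(C)$ with $C$ the component of $G-X$ including $\bigcup\mathcal C_{X'}(Y)$. $\mathfrak F$ is the set of families $(\mathcal F_X)_{X\in\mathcal X}$, $\mathcal F_X\in\mathfrak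 F_X$, with $\mathfrak f_{X',X}(\mathcal F_{X'})=\mathcal F_X$. A separation of $G$ is a set $\{A,B\}$ with $A\cup B=V(G)$ and no edge between $A\setminus B$ and $B\setminus A$; it has finite order if $A\cap B$ is finite. Its orientations are $(A,B)$ and $(B,A)$ (each the inverse of the other); $(A,B)\le(C,D)$ iff $A\subseteq C$ and $B\supseteq D$. $S'$ is the set of finite-order separations of the form $\{X\cup V[\mathcal C],X\cup V[\mathcal C']\}$ with $X\in\mathcal X$ and $\{\mathcal C,\mathcal C'\}$ a partition of $\mathcal C_X$ such that there is no $Y\in\mathrm{crit}(X)$ for which both $\mathcal C_X(Y)\cap\mathcal C$ and $\mathcal C_X(Y)\cap\mathcal C'$ are infinite; $\vec S'$ is the set of orientations of its elements. An orientation $O$ of $S'$ contains exactly one orientation of each element of $S'$; it is consistent if there are no distinct $\vec r,\vec s\in O$ with $\overleftarrow r<\vec s$ ($\overleftarrow r$ the inverse of $\vec r$). A star is a nonempty set $\sigma$ of oriented separations with $\vec r\le\overleftarrow s$ for all distinct $\vec r,\vec s\in\sigma$; its interior is $\bigcap B$ over $(A,B)\in\sigma$. An $\aleph_0$-tangle with respect to $S'$ is a consistent orientation of $S'$ that includes no finite star with finite interior. For such $\tau$ and $X\in\mathcal X$, $\mathcal F(\tau,X)=\{\mathcal C\subseteq\mathcal C_X:(V[\mathcal C_X\setminus\mathcal C]\cup X,\ X\cup V[\mathcal C])\in\tau\}$.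
   Formalization: F(τ,X) is replaced by its up-closure in the power set of C_X, since F(τ,X) itself need not lie in 𝔉_X (e.g. two disjoint infinite stars, X their two centres); where the literal claim holds the two agree. Partitions {C,C'} may have an empty class. *)

theory Defs
  imports Main "HOL-Library.FuncSet" "HOL-Library.Infinite_Set"
begin

section \<open>Graphs and components\<close>

definition simple_graph :: "'a set \<Rightarrow> 'a set set \<Rightarrow> bool" where
  "simple_graph V E \<longleftrightarrow> (\<forall>e\<in>E. e \<subseteq> V \<and> card e = 2)"

definition finsubs :: "'a set \<Rightarrow> 'a set set" where
  "finsubs V = {X. X \<subseteq> V \<and> finite X}"

definition edge_rel :: "'a set set \<Rightarrow> 'a set \<Rightarrow> ('a \<times> 'a) set" where
  "edge_rel E U = {(u, v). u \<in> U \<and> v \<in> U \<and> {u, v} \<in> E}"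

text \<open>A component of \<open>G - X\<close> is represented by its vertex set, so the vertex set of the union
  of a set \<open>\<C>\<close> of components is just \<open>\<Union>\<C>\<close>.\<close>

definition comps :: "'a set \<Rightarrow> 'a set set \<Rightarrow> 'a set \<Rightarrow> 'a set set" where
  "comps V E X = {{w \<in> V - X. (v, w) \<in> (edge_rel E (V - X))\<^sup>*} | v. v \<in> V - X}"

definition nbhd :: "'a set \<Rightarrow> 'a set set \<Rightarrow> 'a set \<Rightarrow> 'a set" where
  "nbhd V E C = {v \<in> V - C. \<exists>u\<in>C. {u, v} \<in> E}"

definition comp_map :: "'a set \<Rightarrow> 'a set set \<Rightarrow> 'a set \<Rightarrow> 'a set \<Rightarrow> 'a set" where
  "comp_map V E X C' = (THE C. C \<in> comps V E X \<and> C' \<subseteq> C)"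

definition comps_at :: "'a set \<Rightarrow> 'a set set \<Rightarrow> 'a set \<Rightarrow> 'a set \<Rightarrow> 'a set set" where
  "comps_at V E X Y = {C \<in> comps V E X. nbhd V E C = Y}"

definition crit :: "'a set \<Rightarrow> 'a set set \<Rightarrow> 'a set \<Rightarrow> 'a set set" where
  "crit V E X = {Y. Y \<subseteq> X \<and> infinite (comps_at V E X Y)}"


section \<open>The inverse system\<close>

definition principal_uf :: "'a set \<Rightarrow> 'a set set \<Rightarrow> 'a set \<Rightarrow> 'a set \<Rightarrow> 'a set set set" where
  "principal_uf V E X C = {\<C>. \<C> \<subseteq> comps V E X \<and> C \<in> \<C>}"

definition crit_filter :: "'a set \<Rightarrow> 'a set set \<Rightarrow> 'a set \<Rightarrow> 'a set \<Rightarrow> 'a set set set" where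
  "crit_filter V E X Y = {\<C>. \<C> \<subseteq> comps V E X \<and>
     (\<exists>\<D> \<subseteq> comps_at V E X Y. finite (comps_at V E X Y - \<D>) \<and> \<D> \<subseteq> \<C>)}"

definition filters_at :: "'a set \<Rightarrow> 'a set set \<Rightarrow> 'a set \<Rightarrow> 'a set set set set" where
  "filters_at V E X =
     principal_uf V E X ` comps V E X \<union> crit_filter V E X ` crit V E X"

text \<open>The bonding map is given by cases on how an element of \<open>filters_at V E X'\<close> is presented.
  The presentation is unique, so the description below determines the value; see
  \<open>bond_principal_uf\<close> and \<open>bond_crit_filter\<close>.\<close>

definition bond ::
  "'a set \<Rightarrow> 'a set set \<Rightarrow> 'a set \<Rightarrow> 'a set \<Rightarrow> 'a set set set \<Rightarrow> 'a set set set" where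
  "bond V E X' X \<U> = (THE \<W>.
     (\<exists>C'\<in>comps V E X'. \<U> = principal_uf V E X' C' \<and>
        \<W> = principal_uf V E X (comp_map V E X C')) \<or>
     (\<exists>Y\<in>crit V E X'. \<U> = crit_filter V E X' Y \<and>
        \<W> = (if Y \<subseteq> X then crit_filter V E X Y
              else principal_uf V E X
                (THE C. C \<in> comps V E X \<and> \<Union>(comps_at V E X' Y) \<subseteq> C))))"

definition inverse_limit :: "'a set \<Rightarrow> 'a set set \<Rightarrow> ('a set \<Rightarrow> 'a set set set) set" where
  "inverse_limit V E = {\<Phi> \<in> Pi\<^sub>E (finsubs V) (filters_at V E).
     \<forall>X\<in>finsubs V. \<forall>X'\<in>finsubs V. X \<subseteq> X' \<longrightarrow> bond V E X' X (\<Phi> X') = \<Phi> X}"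


section \<open>Separations and tangles\<close>

type_synonym 'a osep = "'a set \<times> 'a set"

definition finite_order_seps :: "'a set \<Rightarrow> 'a set set \<Rightarrow> 'a set set set" where
  "finite_order_seps V E = {{A, B} | A B. A \<union> B = V \<and>
     (\<forall>a\<in>A - B. \<forall>b\<in>B - A. {a, b} \<notin> E) \<and> finite (A \<inter> B)}"

text \<open>A class of the bipartition \<open>{\<C>, \<C>'}\<close> may be empty: the separations \<open>{X, V}\<close> belong to the
  system.\<close>

definition crit_seps :: "'a set \<Rightarrow> 'a set set \<Rightarrow> 'a set set set" where
  "crit_seps V E = {s \<in> finite_order_seps V E. \<exists>X\<in>finsubs V. \<exists>\<C> \<C>'.
     \<C> \<union> \<C>' = comps V E X \<and> \<C> \<inter> \<C>' = {} \<and>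
     \<not> (\<exists>Y\<in>crit V E X. infinite (comps_at V E X Y \<inter> \<C>) \<and> infinite (comps_at V E X Y \<inter> \<C>')) \<and>
     s = {X \<union> \<Union>\<C>, X \<union> \<Union>\<C>'}}"

definition orientations :: "'a set set \<Rightarrow> 'a osep set" where
  "orientations s = {(A, B). s = {A, B}}"

definition osep_le :: "'a osep \<Rightarrow> 'a osep \<Rightarrow> bool" where
  "osep_le r s \<longleftrightarrow> fst r \<subseteq> fst s \<and> snd r \<supseteq> snd s"

definition osep_less :: "'a osep \<Rightarrow> 'a osep \<Rightarrow> bool" where
  "osep_less r s \<longleftrightarrow> osep_le r s \<and> r \<noteq> s"

definition orientation_of :: "'a set set set \<Rightarrow> 'a osep set \<Rightarrow> bool" where
  "orientation_of S O' \<longleftrightarrow> O' \<subseteq> (\<Union>s\<in>S. orientations s) \<and>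
     (\<forall>s\<in>S. \<exists>!r. r \<in> O' \<and> r \<in> orientations s)"

definition consistent :: "'a osep set \<Rightarrow> bool" where
  "consistent O' \<longleftrightarrow> \<not> (\<exists>r\<in>O'. \<exists>s\<in>O'. r \<noteq> s \<and> osep_less (prod.swap r) s)"

definition star :: "'a osep set \<Rightarrow> bool" where
  "star \<sigma> \<longleftrightarrow> \<sigma> \<noteq> {} \<and> (\<forall>r\<in>\<sigma>. \<forall>s\<in>\<sigma>. r \<noteq> s \<longrightarrow> osep_le r (prod.swap s))"

definition star_interior :: "'a osep set \<Rightarrow> 'a set" where
  "star_interior \<sigma> = (\<Inter>s\<in>\<sigma>. snd s)"

definition aleph0_tangle :: "'a set set set \<Rightarrow> 'a osep set \<Rightarrow> bool" where
  "aleph0_tangle S \<tau> \<longleftrightarrow> orientation_of S \<tau> \<and> consistent \<tau> \<and>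
     \<not> (\<exists>\<sigma>\<subseteq>\<tau>. finite \<sigma> \<and> star \<sigma> \<and> finite (star_interior \<sigma>))"

definition tangle_sets :: "'a set \<Rightarrow> 'a set set \<Rightarrow> 'a osep set \<Rightarrow> 'a set \<Rightarrow> 'a set set set" where
  "tangle_sets V E \<tau> X =
     {\<C>. \<C> \<subseteq> comps V E X \<and> (\<Union>(comps V E X - \<C>) \<union> X, X \<union> \<Union>\<C>) \<in> \<tau>}"

text \<open>A tangle orients only those bipartitions of the set of components of \<open>G - X\<close> that split no
  critical subset of \<open>X\<close> into two infinite parts, whereas the members of \<open>filters_at V E X\<close> are
  closed under arbitrary supersets. Hence \<open>tangle_sets V E \<tau> X\<close> itself need not be a filter on
  the set of components, nor a member of \<open>filters_at V E X\<close>; it is not a member if \<open>X\<close> has two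
  critical subsets (\<open>tangle_sets_neq_principal_uf\<close>, \<open>tangle_sets_neq_crit_filter\<close>). It is
  therefore read as a filter base.\<close>

definition tangle_filter :: "'a set \<Rightarrow> 'a set set \<Rightarrow> 'a osep set \<Rightarrow> 'a set \<Rightarrow> 'a set set set" where
  "tangle_filter V E \<tau> X =
     {\<C>. \<C> \<subseteq> comps V E X \<and> (\<exists>\<D>\<in>tangle_sets V E \<tau> X. \<D> \<subseteq> \<C>)}"


section \<open>Basic facts\<close>

lemma comps_subset: "C \<in> comps V E X \<Longrightarrow> C \<subseteq> V - X"
  by (auto simp: comps_def)

lemma comps_nonempty: "C \<in> comps V E X \<Longrightarrow> C \<noteq> {}"
  by (auto simp: comps_def)

lemma edge_rel_sym: "sym ((edge_rel E U)\<^sup>*)"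
  by (rule sym_rtrancl) (auto simp: sym_def edge_rel_def insert_commute)

lemma comps_disjoint:
  assumes "C \<in> comps V E X" "D \<in> comps V E X" "C \<inter> D \<noteq> {}"
  shows "C = D"
proof -
  let ?R = "(edge_rel E (V - X))\<^sup>*"
  obtain c d where c: "C = {w \<in> V - X. (c, w) \<in> ?R}" and d: "D = {w \<in> V - X. (d, w) \<in> ?R}"
    using assms(1,2) by (auto simp: comps_def)
  obtain z where z: "(c, z) \<in> ?R" "(d, z) \<in> ?R"
    using assms(3) c d by auto
  have cd: "(c, d) \<in> ?R" "(d, c) \<in> ?R"
    using z edge_rel_sym[of E "V - X"] by (meson rtrancl_trans symD)+
  show ?thesis
    using cd c d by (auto intro: rtrancl_trans)
qed

lemma comps_Union_inj:
  assumes "\<C> \<subseteq> comps V E X" "\<D> \<subseteq> comps V E X" "\<Union>\<C> = \<Union>\<D>"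
  shows "\<C> = \<D>"
proof -
  have "\<A> \<subseteq> \<B>" if "\<A> \<subseteq> comps V E X" "\<B> \<subseteq> comps V E X" "\<Union>\<A> = \<Union>\<B>" for \<A> \<B>
  proof
    fix C assume C: "C \<in> \<A>"
    then have "C \<noteq> {}" using that(1) comps_nonempty by blast
    then obtain z where z: "z \<in> C" by blast
    then have "z \<in> \<Union>\<B>" using C that(3) by blast
    then obtain D where "D \<in> \<B>" "z \<in> D" by blast
    then show "C \<in> \<B>" using comps_disjoint[of C V E X D] that C z by blast
  qed
  then show ?thesis using assms by (metis subset_antisym)
qed

lemma principal_uf_inj:
  assumes "C \<in> comps V E X" "principal_uf V E X C = principal_uf V E X D"
  shows "C = D"
proof -
  have "{C} \<in> principal_uf V E X C" using assms(1) by (simp add: principal_uf_def)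
  then have "{C} \<in> principal_uf V E X D" using assms(2) by simp
  then show ?thesis by (simp add: principal_uf_def)
qed

lemma comps_at_in_crit_filter: "comps_at V E X Y \<in> crit_filter V E X Y"
  unfolding crit_filter_def mem_Collect_eq
  by (intro conjI exI[of _ "comps_at V E X Y"]) (auto simp: comps_at_def)

lemma crit_filter_inj:
  assumes "Y \<in> crit V E X" "crit_filter V E X Y = crit_filter V E X Z"
  shows "Y = Z"
proof -
  have "comps_at V E X Z \<in> crit_filter V E X Y"
    using assms(2) comps_at_in_crit_filter by metis
  then obtain \<D> where "\<D> \<subseteq> comps_at V E X Y" "finite (comps_at V E X Y - \<D>)"
      "\<D> \<subseteq> comps_at V E X Z"
    by (auto simp: crit_filter_def)
  moreover from this have "\<D> \<noteq> {}" using assms(1) by (auto simp: crit_def)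
  ultimately show ?thesis by (auto simp: comps_at_def)
qed

lemma crit_filter_neq_principal_uf:
  assumes "Y \<in> crit V E X" "C \<in> comps V E X"
  shows "crit_filter V E X Y \<noteq> principal_uf V E X C"
proof
  assume eq: "crit_filter V E X Y = principal_uf V E X C"
  have "{C} \<in> crit_filter V E X Y" unfolding eq using assms(2) by (simp add: principal_uf_def)
  then obtain \<D> where D: "finite (comps_at V E X Y - \<D>)" "\<D> \<subseteq> {C}"
    by (auto simp: crit_filter_def)
  have "finite \<D>" using D(2) by (rule finite_subset) simp
  then have "finite (comps_at V E X Y)" using D(1) by simp
  then show False using assms(1) by (simp add: crit_def)
qed

lemma bond_principal_uf:
  assumes "C' \<in> comps V E X'"
  shows "bond V E X' X (principal_uf V E X' C') = principal_uf V E X (comp_map V E X C')"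
  unfolding bond_def
proof (rule the_equality, goal_cases)
  case 1
  then show ?case using assms by blast
next
  case (2 \<W>)
  then show ?case
    using assms principal_uf_inj[OF assms] crit_filter_neq_principal_uf[OF _ assms] by metis
qed

lemma bond_crit_filter:
  assumes "Y \<in> crit V E X'"
  shows "bond V E X' X (crit_filter V E X' Y) =
    (if Y \<subseteq> X then crit_filter V E X Y
     else principal_uf V E X (THE C. C \<in> comps V E X \<and> \<Union>(comps_at V E X' Y) \<subseteq> C))"
  unfolding bond_def
proof (rule the_equality, goal_cases)
  case 1
  then show ?case using assms by blast
next
  case (2 \<W>)
  then show ?case
    using crit_filter_inj[OF assms] crit_filter_neq_principal_uf[OF assms] by metis
qed

lemma tangle_sets_unsplit:
  assumes \<tau>: "\<tau> \<subseteq> (\<Union>s\<in>crit_seps V E. orientations s)"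
    and C: "\<C> \<in> tangle_sets V E \<tau> X" and Y: "Y \<in> crit V E X"
  shows "finite (comps_at V E X Y \<inter> \<C>) \<or> finite (comps_at V E X Y - \<C>)"
proof -
  let ?\<D> = "comps V E X - \<C>"
  have sub: "\<C> \<subseteq> comps V E X" using C by (simp add: tangle_sets_def)
  have "(X \<union> \<Union>?\<D>, X \<union> \<Union>\<C>) \<in> (\<Union>s\<in>crit_seps V E. orientations s)"
    using C \<tau> unfolding tangle_sets_def by (metis (no_types, lifting) Un_commute mem_Collect_eq subsetD)
  then have "{X \<union> \<Union>?\<D>, X \<union> \<Union>\<C>} \<in> crit_seps V E"
    by (auto simp: orientations_def)
  then obtain X' \<A> \<B> where p: "\<A> \<union> \<B> = comps V E X'" "\<A> \<inter> \<B> = {}"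
    and ns: "\<not> (\<exists>Y\<in>crit V E X'. infinite (comps_at V E X' Y \<inter> \<A>) \<and>
               infinite (comps_at V E X' Y \<inter> \<B>))"
    and eq: "{X \<union> \<Union>?\<D>, X \<union> \<Union>\<C>} = {X' \<union> \<Union>\<A>, X' \<union> \<Union>\<B>}"
    unfolding crit_seps_def mem_Collect_eq by (elim conjE bexE exE) (rule that)
  have dis: "Z \<inter> \<Union>\<P> = {}" if "\<P> \<subseteq> comps V E Z" for Z \<P>
    using that comps_subset by blast
  have meet: "(Z \<union> \<Union>\<P>) \<inter> (Z \<union> \<Union>\<Q>) = Z"
    if "\<P> \<subseteq> comps V E Z" "\<Q> \<subseteq> comps V E Z" "\<P> \<inter> \<Q> = {}" for Z \<P> \<Q>
  proof -
    have "P \<inter> Q = {}" if "P \<in> \<P>" "Q \<in> \<Q>" for P Q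
      using comps_disjoint[of P V E Z Q] that \<open>\<P> \<subseteq> _\<close> \<open>\<Q> \<subseteq> _\<close> \<open>\<P> \<inter> \<Q> = {}\<close> by blast
    then have "\<Union>\<P> \<inter> \<Union>\<Q> = {}" by blast
    then show ?thesis by blast
  qed
  have "\<Inter>{X \<union> \<Union>?\<D>, X \<union> \<Union>\<C>} = X" using meet[OF Diff_subset sub] by (simp add: Int_commute)
  moreover have "\<Inter>{X' \<union> \<Union>\<A>, X' \<union> \<Union>\<B>} = X'"
    using meet[of \<A> X' \<B>] p(2) unfolding p(1)[symmetric] by simp
  ultimately have X: "X' = X" using eq by simp
  have cancel: "\<P> = \<Q>"
    if "X \<union> \<Union>\<P> = X \<union> \<Union>\<Q>" "\<P> \<subseteq> comps V E X" "\<Q> \<subseteq> comps V E X" for \<P> \<Q>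
  proof -
    have "\<Union>\<P> = \<Union>\<Q>" using that(1) dis[OF that(2)] dis[OF that(3)] by blast
    then show ?thesis by (rule comps_Union_inj[OF that(2,3)])
  qed
  have AB: "\<A> \<subseteq> comps V E X" "\<B> \<subseteq> comps V E X" using p X by auto
  have "(?\<D> = \<A> \<and> \<C> = \<B>) \<or> (?\<D> = \<B> \<and> \<C> = \<A>)"
    using eq[unfolded X doubleton_eq_iff] cancel[OF _ Diff_subset AB(1)]
      cancel[OF _ Diff_subset AB(2)] cancel[OF _ sub AB(1)] cancel[OF _ sub AB(2)] by blast
  moreover have "comps_at V E X Y - \<C> = comps_at V E X Y \<inter> ?\<D>"
    by (auto simp: comps_at_def)
  moreover have "finite (comps_at V E X Y \<inter> \<A>) \<or> finite (comps_at V E X Y \<inter> \<B>)"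
    using ns Y unfolding X by blast
  ultimately show ?thesis by metis
qed

lemma tangle_sets_neq_principal_uf:
  assumes "\<tau> \<subseteq> (\<Union>s\<in>crit_seps V E. orientations s)" "Y \<in> crit V E X" "C \<in> comps V E X"
  shows "tangle_sets V E \<tau> X \<noteq> principal_uf V E X C"
proof
  assume eq: "tangle_sets V E \<tau> X = principal_uf V E X C"
  obtain B where B: "B \<subseteq> comps_at V E X Y" "infinite B" "infinite (comps_at V E X Y - B)"
  proof -
    have "infinite (comps_at V E X Y)" using assms(2) by (simp add: crit_def)
    then obtain B B' where "B \<subseteq> comps_at V E X Y" "B' \<subseteq> comps_at V E X Y"
        "infinite B" "infinite B'" "B \<inter> B' = {}"
      by (rule infinite_split)
    moreover from this have "B' \<subseteq> comps_at V E X Y - B" by blast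
    ultimately show thesis using that infinite_super by blast
  qed
  have "insert C B \<in> tangle_sets V E \<tau> X"
    unfolding eq principal_uf_def using B(1) assms(3) by (auto simp: comps_at_def)
  from tangle_sets_unsplit[OF assms(1) this assms(2)]
  show False
  proof
    assume "finite (comps_at V E X Y \<inter> insert C B)"
    moreover have "B \<subseteq> comps_at V E X Y \<inter> insert C B" using B(1) by blast
    ultimately show False using B(2) finite_subset by blast
  next
    assume "finite (comps_at V E X Y - insert C B)"
    moreover have "comps_at V E X Y - B \<subseteq> insert C (comps_at V E X Y - insert C B)" by blast
    ultimately show False using B(3) by (meson finite_insert finite_subset)
  qed
qed

lemma tangle_sets_neq_crit_filter:
  assumes "\<tau> \<subseteq> (\<Union>s\<in>crit_seps V E. orientations s)" "Y \<in> crit V E X" "Z \<in> crit V E X" "Y \<noteq> Z"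
  shows "tangle_sets V E \<tau> X \<noteq> crit_filter V E X Z"
proof
  assume eq: "tangle_sets V E \<tau> X = crit_filter V E X Z"
  obtain B where B: "B \<subseteq> comps_at V E X Y" "infinite B" "infinite (comps_at V E X Y - B)"
  proof -
    have "infinite (comps_at V E X Y)" using assms(2) by (simp add: crit_def)
    then obtain B B' where "B \<subseteq> comps_at V E X Y" "B' \<subseteq> comps_at V E X Y"
        "infinite B" "infinite B'" "B \<inter> B' = {}"
      by (rule infinite_split)
    moreover from this have "B' \<subseteq> comps_at V E X Y - B" by blast
    ultimately show thesis using that infinite_super by blast
  qed
  have YZ: "comps_at V E X Y \<inter> comps_at V E X Z = {}"
    using assms(4) by (auto simp: comps_at_def)
  have sub: "comps_at V E X Z \<union> B \<subseteq> comps V E X"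
    using B(1) by (auto simp: comps_at_def)
  have "comps_at V E X Z \<union> B \<in> tangle_sets V E \<tau> X"
    unfolding eq crit_filter_def mem_Collect_eq
    by (intro conjI sub exI[of _ "comps_at V E X Z"]) simp_all
  moreover have "comps_at V E X Y \<inter> (comps_at V E X Z \<union> B) = B"
      "comps_at V E X Y - (comps_at V E X Z \<union> B) = comps_at V E X Y - B"
    using B(1) YZ by auto
  ultimately have "finite B \<or> finite (comps_at V E X Y - B)"
    using tangle_sets_unsplit[OF assms(1) _ assms(2)] by metis
  then show False using B by blast
qed

end

theory Submission
  imports Defs
begin

text \<open>For finite \<open>X\<close>, the sides \<open>\<D>\<close> of the admissible bipartitions of the set of components of
  \<open>G - X\<close> form a Boolean algebra (\<open>unsplit_sets\<close>), and a tangle induces an ultrafilter on it.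
  Since only finitely many subsets of \<open>X\<close> occur as neighbourhoods, such an ultrafilter is generated
  either by a single component or by the cofinite subsets of the set of components attached to some
  critical \<open>Y\<close>. If \<open>X \<subseteq> X'\<close>, a separation \<open>(A, B)\<close> at \<open>X\<close> and its lift \<open>(A \<union> X', B \<union> X')\<close> are
  oriented alike, because \<open>(A, B \<union> X')\<close> lies below \<open>(A, B)\<close> and forms a star of finite interior
  with the inverse of the lift; this makes the ultrafilters compatible. Conversely, the
  separations selected by a limit point have the property that finitely many of their big sides
  always have infinite intersection, which excludes both inconsistency and forbidden stars.\<close>

section \<open>Components\<close>

lemma Union_comps: "\<Union>(comps V E X) = V - X"
proof
  show "\<Union>(comps V E X) \<subseteq> V - X" using comps_subset by blast
  show "V - X \<subseteq> \<Union>(comps V E X)"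
  proof
    fix v assume v: "v \<in> V - X"
    then have "{w \<in> V - X. (v, w) \<in> (edge_rel E (V - X))\<^sup>*} \<in> comps V E X"
      by (auto simp: comps_def)
    with v show "v \<in> \<Union>(comps V E X)" by blast
  qed
qed

lemma comps_eqI:
  "C \<in> comps V E X \<Longrightarrow> D \<in> comps V E X \<Longrightarrow> v \<in> C \<Longrightarrow> v \<in> D \<Longrightarrow> C = D"
  using comps_disjoint by blast

lemma comps_adjacent:
  assumes C: "C \<in> comps V E X" and u: "u \<in> C" and v: "v \<in> V - X" and e: "{u, v} \<in> E"
  shows "v \<in> C"
proof -
  obtain c where c: "C = {w \<in> V - X. (c, w) \<in> (edge_rel E (V - X))\<^sup>*}"
    using C by (auto simp: comps_def)
  have "(u, v) \<in> edge_rel E (V - X)" using u v e c by (auto simp: edge_rel_def)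
  then show ?thesis using u v c by (auto intro: rtrancl_into_rtrancl)
qed

text \<open>Induction along a path from \<open>s\<close> to an arbitrary vertex of \<open>C\<close>:
  each edge of the path stays in \<open>C\<close> and, by \<open>closed\<close>, in
  \<open>S\<close>.\<close>

lemma comps_connected:
  assumes C: "C \<in> comps V E X" and s: "s \<in> C" "s \<in> S"
    and closed: "\<And>u v. u \<in> S \<Longrightarrow> u \<in> C \<Longrightarrow> v \<in> C \<Longrightarrow> {u, v} \<in> E \<Longrightarrow> v \<in> S"
  shows "C \<subseteq> S"
proof
  fix w assume w: "w \<in> C"
  let ?R = "(edge_rel E (V - X))\<^sup>*"
  obtain c where c: "C = {w \<in> V - X. (c, w) \<in> ?R}"
    using C by (auto simp: comps_def)
  have "(s, c) \<in> ?R" using s(1) c edge_rel_sym[of E "V - X"] by (auto dest: symD)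
  then have "(s, w) \<in> ?R" using w c by (auto intro: rtrancl_trans)
  then have "w \<in> S \<and> w \<in> C"
  proof (induction rule: rtrancl_induct)
    case base
    show ?case using s by simp
  next
    case (step y z)
    then have "z \<in> V - X" "{y, z} \<in> E" by (auto simp: edge_rel_def)
    with step closed comps_adjacent[OF C, of y z] show ?case by blast
  qed
  then show "w \<in> S" ..
qed

lemma comps_contained:
  assumes XX: "X \<subseteq> X'" and C': "C' \<in> comps V E X'"
  obtains C where "C \<in> comps V E X" "C' \<subseteq> C"
proof -
  obtain c where c: "c \<in> C'" using comps_nonempty[OF C'] by blast
  have sub: "C' \<subseteq> V - X" using comps_subset[OF C'] XX by blast
  then obtain C where C: "C \<in> comps V E X" "c \<in> C" using c Union_comps[of V E X] by blast
  have "C' \<subseteq> C"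
    by (rule comps_connected[OF C' c C(2)]) (use comps_adjacent[OF C(1)] sub in blast)
  then show thesis using that C by blast
qed

lemma comp_map_eq:
  assumes "C' \<in> comps V E X'" "C \<in> comps V E X" "C' \<subseteq> C"
  shows "comp_map V E X C' = C"
  unfolding comp_map_def
proof (rule the_equality)
  show "C \<in> comps V E X \<and> C' \<subseteq> C" using assms by simp
  show "D = C" if "D \<in> comps V E X \<and> C' \<subseteq> D" for D
    using that assms comps_nonempty[OF assms(1)] comps_disjoint[of D V E X C] by blast
qed

lemma nbhd_comps:
  assumes "C \<in> comps V E X"
  shows "nbhd V E C \<subseteq> X"
  using comps_adjacent[OF assms] unfolding nbhd_def by blast

text \<open>An edge leaving \<open>C'\<close> ends in \<open>X\<close>, so the component of
  \<open>G - X\<close> around \<open>C'\<close> cannot extend beyond \<open>C'\<close>.\<close>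

lemma comps_smaller:
  assumes XX: "X \<subseteq> X'" and C': "C' \<in> comps V E X'" and N: "nbhd V E C' \<subseteq> X"
  shows "C' \<in> comps V E X"
proof -
  obtain C where C: "C \<in> comps V E X" "C' \<subseteq> C" using comps_contained[OF XX C'] .
  obtain c where c: "c \<in> C'" using comps_nonempty[OF C'] by blast
  have "C \<subseteq> C'"
  proof (rule comps_connected[OF C(1) _ c])
    show "c \<in> C" using c C by blast
    show "v \<in> C'" if "u \<in> C'" "v \<in> C" "{u, v} \<in> E" for u v
      using that N comps_subset[OF C(1)] unfolding nbhd_def by blast
  qed
  then have "C = C'" using C by blast
  then show ?thesis using C by simp
qed

lemma comps_at_mono:
  assumes "X \<subseteq> X'" "Y \<subseteq> X"
  shows "comps_at V E X' Y \<subseteq> comps_at V E X Y"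
  using comps_smaller[OF assms(1)] assms(2) by (auto simp: comps_at_def)

lemma crit_mono:
  assumes "X \<subseteq> X'" "Y \<subseteq> X" "Y \<in> crit V E X'"
  shows "Y \<in> crit V E X"
  using assms comps_at_mono[OF assms(1,2), of V E] by (auto simp: crit_def dest: finite_subset)

text \<open>Every component attached to \<open>Y\<close> is adjacent to a fixed vertex
  \<open>y\<close> of \<open>Y\<close> outside \<open>X\<close>, hence lies in the component of
  \<open>G - X\<close> containing \<open>y\<close>. As some such component exists, the target is
  unique, which evaluates the description in \<open>bond\<close>.\<close>

lemma comps_at_in_one_comp:
  assumes XX: "X \<subseteq> X'" and Y: "\<not> Y \<subseteq> X"
    and ne: "comps_at V E X' Y \<noteq> {}"
  obtains C where "C \<in> comps V E X" "\<Union>(comps_at V E X' Y) \<subseteq> C"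
    "(THE C. C \<in> comps V E X \<and> \<Union>(comps_at V E X' Y) \<subseteq> C) = C"
proof -
  obtain y where y: "y \<in> Y" "y \<notin> X" using Y by blast
  have "y \<in> V" using ne y by (auto simp: comps_at_def nbhd_def)
  then obtain C where C: "C \<in> comps V E X" "y \<in> C" using y Union_comps[of V E X] by blast
  have "D \<subseteq> C" if D: "D \<in> comps_at V E X' Y" for D
  proof -
    have D': "D \<in> comps V E X'" "nbhd V E D = Y" using D by (auto simp: comps_at_def)
    obtain u where u: "u \<in> D" "{u, y} \<in> E" using y D' by (auto simp: nbhd_def)
    obtain C1 where C1: "C1 \<in> comps V E X" "D \<subseteq> C1" using comps_contained[OF XX D'(1)] .
    have "y \<in> C1" using comps_adjacent[OF C1(1), of u y] u C1 y \<open>y \<in> V\<close> by blast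
    then show ?thesis using comps_eqI[OF C1(1) C(1)] C C1 by blast
  qed
  then have sub: "\<Union>(comps_at V E X' Y) \<subseteq> C" by blast
  obtain D where D: "D \<in> comps_at V E X' Y" using ne by blast
  then have "D \<noteq> {}" by (auto simp: comps_at_def dest: comps_nonempty)
  then obtain d where d: "d \<in> D" by blast
  have "(THE C. C \<in> comps V E X \<and> \<Union>(comps_at V E X' Y) \<subseteq> C) = C"
  proof (rule the_equality)
    show "B = C" if "B \<in> comps V E X \<and> \<Union>(comps_at V E X' Y) \<subseteq> B" for B
      by (rule comps_eqI[of B V E X C d]) (use that C D d sub in auto)
  qed (use C sub in blast)
  then show thesis using that C(1) sub by blast
qed


section \<open>Unsplit sets of components\<close>

definition unsplit_sets :: "'a set \<Rightarrow> 'a set set \<Rightarrow> 'a set \<Rightarrow> 'a set set set" where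
  "unsplit_sets V E X = {\<D>. \<D> \<subseteq> comps V E X \<and>
     (\<forall>Y\<in>crit V E X. finite (comps_at V E X Y \<inter> \<D>) \<or> finite (comps_at V E X Y - \<D>))}"

lemma unsplit_sets_subset: "\<D> \<in> unsplit_sets V E X \<Longrightarrow> \<D> \<subseteq> comps V E X"
  by (simp add: unsplit_sets_def)

lemma unsplit_sets_compl:
  assumes "\<D> \<in> unsplit_sets V E X"
  shows "comps V E X - \<D> \<in> unsplit_sets V E X"
proof -
  have "comps_at V E X Y \<inter> (comps V E X - \<D>) = comps_at V E X Y - \<D>"
    "comps_at V E X Y - (comps V E X - \<D>) = comps_at V E X Y \<inter> \<D>" for Y
    by (auto simp: comps_at_def)
  then show ?thesis using assms by (auto simp: unsplit_sets_def)
qed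

lemma unsplit_sets_Int:
  assumes "\<C> \<in> unsplit_sets V E X" "\<D> \<in> unsplit_sets V E X"
  shows "\<C> \<inter> \<D> \<in> unsplit_sets V E X"
proof -
  have "finite (comps_at V E X Y \<inter> (\<C> \<inter> \<D>)) \<or> finite (comps_at V E X Y - \<C> \<inter> \<D>)"
    if "Y \<in> crit V E X" for Y
  proof -
    have "finite (comps_at V E X Y \<inter> (\<C> \<inter> \<D>))"
      if "finite (comps_at V E X Y \<inter> \<C>) \<or> finite (comps_at V E X Y \<inter> \<D>)"
      using that by (elim disjE) (erule finite_subset[rotated], blast)+
    then show ?thesis using assms that by (auto simp: unsplit_sets_def Diff_Int)
  qed
  then show ?thesis using assms by (auto simp: unsplit_sets_def)
qed

lemma unsplit_sets_finite:
  "\<F> \<subseteq> comps V E X \<Longrightarrow> finite \<F> \<Longrightarrow> \<F> \<in> unsplit_sets V E X"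
  by (simp add: unsplit_sets_def)

lemma unsplit_sets_comps: "comps V E X \<in> unsplit_sets V E X"
  using unsplit_sets_compl[OF unsplit_sets_finite[of "{}"]] by simp

text \<open>A component has only one neighbourhood, so two sets of this form at the same
  \<open>X\<close> are equal or disjoint.\<close>

lemma comps_at_unsplit: "comps_at V E X Y \<in> unsplit_sets V E X"
proof -
  have "comps_at V E X Z \<inter> comps_at V E X Y = {} \<or> comps_at V E X Z - comps_at V E X Y = {}" for Z
    by (auto simp: comps_at_def)
  then have "finite (comps_at V E X Z \<inter> comps_at V E X Y) \<or>
      finite (comps_at V E X Z - comps_at V E X Y)" for Z
    by (metis finite.emptyI)
  then show ?thesis by (simp add: unsplit_sets_def comps_at_def)
qed

text \<open>Prepares the use of closure under intersection: for cofinite \<open>\<D>\<close> the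
  second factor is the complement of a finite set.\<close>

lemma cofinite_comps_at_eq:
  assumes "\<D> \<subseteq> comps_at V E X Y"
  shows "\<D> = comps_at V E X Y \<inter> (comps V E X - (comps_at V E X Y - \<D>))"
  using assms by (auto simp: comps_at_def)

lemma cofinite_comps_at_unsplit:
  assumes "\<D> \<subseteq> comps_at V E X Y" "finite (comps_at V E X Y - \<D>)"
  shows "\<D> \<in> unsplit_sets V E X"
proof (subst cofinite_comps_at_eq[OF assms(1)], intro unsplit_sets_Int comps_at_unsplit
    unsplit_sets_compl unsplit_sets_finite)
  show "comps_at V E X Y - \<D> \<subseteq> comps V E X" by (auto simp: comps_at_def)
qed (rule assms(2))

text \<open>For \<open>X \<subseteq> X'\<close> and \<open>\<D> \<subseteq> comps V E X\<close> this
  is the preimage of \<open>\<D>\<close> under \<open>comp_map V E X\<close>, written with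
  inclusions to avoid the definite description.\<close>

definition lift_comps :: "'a set \<Rightarrow> 'a set set \<Rightarrow> 'a set \<Rightarrow> 'a set set \<Rightarrow> 'a set set" where
  "lift_comps V E X' \<D> = {C' \<in> comps V E X'. \<exists>C\<in>\<D>. C' \<subseteq> C}"

text \<open>Each component of \<open>G - X'\<close> lies in a single component of
  \<open>G - X\<close>, so \<open>\<Union>\<D> - X'\<close> is a union of whole components of
  \<open>G - X'\<close>.\<close>

lemma Union_lift_comps:
  assumes XX: "X \<subseteq> X'" and D: "\<D> \<subseteq> comps V E X"
  shows "\<Union>(lift_comps V E X' \<D>) = \<Union>\<D> - X'"
proof
  show "\<Union>(lift_comps V E X' \<D>) \<subseteq> \<Union>\<D> - X'"
    using comps_subset[of _ V E X'] by (fastforce simp: lift_comps_def)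
  show "\<Union>\<D> - X' \<subseteq> \<Union>(lift_comps V E X' \<D>)"
  proof
    fix v assume v: "v \<in> \<Union>\<D> - X'"
    then obtain C where C: "C \<in> \<D>" "v \<in> C" by blast
    then have "v \<in> V - X'" using v D comps_subset[of C V E X] by blast
    then obtain C' where C': "C' \<in> comps V E X'" "v \<in> C'" using Union_comps[of V E X'] by blast
    obtain B where B: "B \<in> comps V E X" "C' \<subseteq> B" using comps_contained[OF XX C'(1)] .
    have "B = C" using comps_eqI[OF B(1), of C v] B C C' D by blast
    then show "v \<in> \<Union>(lift_comps V E X' \<D>)" using C C' B by (auto simp: lift_comps_def)
  qed
qed

text \<open>Sets of components are determined by their vertex sets, and here both have vertex set
  \<open>V - X' - \<Union>\<D>\<close>.\<close>

lemma lift_comps_compl: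
  assumes XX: "X \<subseteq> X'" and D: "\<D> \<subseteq> comps V E X"
  shows "lift_comps V E X' (comps V E X - \<D>) = comps V E X' - lift_comps V E X' \<D>"
proof (rule comps_Union_inj[of _ V E X'])
  have diff: "\<Union>(comps V E Z - \<B>) = V - Z - \<Union>\<B>" if "\<B> \<subseteq> comps V E Z" for \<B> Z
    unfolding Union_comps[of V E Z, symmetric] using that comps_eqI[of _ V E Z] by blast
  have "lift_comps V E X' \<D> \<subseteq> comps V E X'" by (auto simp: lift_comps_def)
  then have "\<Union>(lift_comps V E X' (comps V E X - \<D>)) = (V - X) - \<Union>\<D> - X'"
    "\<Union>(comps V E X' - lift_comps V E X' \<D>) = (V - X') - (\<Union>\<D> - X')"
    using D by (simp_all add: Union_lift_comps[OF XX] diff)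
  then show "\<Union>(lift_comps V E X' (comps V E X - \<D>)) = \<Union>(comps V E X' - lift_comps V E X' \<D>)"
    using XX by auto
qed (auto simp: lift_comps_def)

lemma lift_comps_same_comp:
  assumes "\<D> \<subseteq> comps V E X" "C \<in> comps V E X" "C \<in> comps V E X'"
  shows "C \<in> lift_comps V E X' \<D> \<longleftrightarrow> C \<in> \<D>"
proof
  assume "C \<in> lift_comps V E X' \<D>"
  then obtain D where D: "D \<in> \<D>" "C \<subseteq> D" by (auto simp: lift_comps_def)
  then have "C = D" using comps_disjoint[OF assms(2), of D] assms comps_nonempty[OF assms(2)] by blast
  with D show "C \<in> \<D>" by simp
qed (use assms in \<open>auto simp: lift_comps_def\<close>)

text \<open>A component of \<open>G - X'\<close> attached to \<open>Y \<subseteq> X\<close> is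
  already a component of \<open>G - X\<close>, and distinct components of \<open>G - X\<close> are
  never nested.\<close>

lemma lift_comps_comps_at:
  assumes XX: "X \<subseteq> X'" and Y: "Y \<subseteq> X" and D: "\<D> \<subseteq> comps V E X"
    and C: "C \<in> comps_at V E X' Y"
  shows "C \<in> lift_comps V E X' \<D> \<longleftrightarrow> C \<in> \<D>"
  using lift_comps_same_comp[OF D] C comps_at_mono[OF XX Y, of V E] by (auto simp: comps_at_def)

text \<open>If \<open>Y \<subseteq> X\<close>, the two parts into which the lift divides
  \<open>comps_at V E X' Y\<close> are contained in the corresponding parts at \<open>X\<close>, one
  of which is finite. Otherwise these components all lie in one component of \<open>G - X\<close>,
  so the lift contains all or none of them.\<close>

lemma lift_comps_unsplit:
  assumes XX: "X \<subseteq> X'" and D: "\<D> \<in> unsplit_sets V E X"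
  shows "lift_comps V E X' \<D> \<in> unsplit_sets V E X'"
proof -
  let ?L = "lift_comps V E X' \<D>"
  have Dsub: "\<D> \<subseteq> comps V E X" using D by (rule unsplit_sets_subset)
  have "finite (comps_at V E X' Y \<inter> ?L) \<or> finite (comps_at V E X' Y - ?L)"
    if Y: "Y \<in> crit V E X'" for Y
  proof (cases "Y \<subseteq> X")
    case True
    have "finite (comps_at V E X Y \<inter> \<D>) \<or> finite (comps_at V E X Y - \<D>)"
      using D crit_mono[OF XX True Y] by (simp add: unsplit_sets_def)
    moreover have "comps_at V E X' Y \<inter> ?L \<subseteq> comps_at V E X Y \<inter> \<D>"
      "comps_at V E X' Y - ?L \<subseteq> comps_at V E X Y - \<D>"
      using lift_comps_comps_at[OF XX True Dsub] comps_at_mono[OF XX True, of V E] by blast+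
    ultimately show ?thesis using finite_subset by metis
  next
    case False
    have "comps_at V E X' Y \<noteq> {}" using Y by (auto simp: crit_def)
    then obtain C where C: "C \<in> comps V E X" "\<Union>(comps_at V E X' Y) \<subseteq> C"
      using comps_at_in_one_comp[OF XX False] by metis
    show ?thesis
    proof (cases "C \<in> \<D>")
      case True
      then have "comps_at V E X' Y - ?L = {}" using C by (auto simp: lift_comps_def comps_at_def)
      then show ?thesis by (metis finite.emptyI)
    next
      case False
      have "B \<notin> ?L" if B: "B \<in> comps_at V E X' Y" for B
      proof
        assume "B \<in> ?L"
        then obtain D where "D \<in> \<D>" "B \<subseteq> D" "B \<noteq> {}" by (auto simp: lift_comps_def dest: comps_nonempty)
        then show False using comps_disjoint[OF C(1), of D] C(2) B False Dsub by blast
      qed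
      then have "comps_at V E X' Y \<inter> ?L = {}" by blast
      then show ?thesis by (metis finite.emptyI)
    qed
  qed
  then show ?thesis by (auto simp: unsplit_sets_def lift_comps_def)
qed


section \<open>Separations\<close>

text \<open>The second side, which contains \<open>\<D>\<close>, is the big one. The term copies the
  one in \<open>tangle_sets\<close>, so that unfolding alone identifies the two.\<close>

definition osep_of :: "'a set \<Rightarrow> 'a set set \<Rightarrow> 'a set \<Rightarrow> 'a set set \<Rightarrow> 'a osep" where
  "osep_of V E X \<D> = (\<Union>(comps V E X - \<D>) \<union> X, X \<union> \<Union>\<D>)"

lemma tangle_sets_osep_of:
  "tangle_sets V E \<tau> X = {\<D>. \<D> \<subseteq> comps V E X \<and> osep_of V E X \<D> \<in> \<tau>}"
  by (simp add: tangle_sets_def osep_of_def)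

lemma swap_osep_of:
  "\<D> \<subseteq> comps V E X \<Longrightarrow> prod.swap (osep_of V E X \<D>) = osep_of V E X (comps V E X - \<D>)"
  by (simp add: osep_of_def double_diff Un_commute)

lemma osep_of_Int:
  assumes "\<D> \<subseteq> comps V E X"
  shows "fst (osep_of V E X \<D>) \<inter> snd (osep_of V E X \<D>) = X"
proof -
  have "\<Union>(comps V E X - \<D>) \<inter> \<Union>\<D> = {}" using assms comps_eqI[of _ V E X] by blast
  then show ?thesis by (auto simp: osep_of_def)
qed

lemma osep_of_Un:
  assumes "\<D> \<subseteq> comps V E X" "X \<subseteq> V"
  shows "fst (osep_of V E X \<D>) \<union> snd (osep_of V E X \<D>) = V"
proof -
  have "\<Union>(comps V E X - \<D>) \<union> \<Union>\<D> = V - X" using assms(1) Union_comps[of V E X] by blast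
  then show ?thesis using assms(2) by (auto simp: osep_of_def)
qed

text \<open>The separator is the intersection of the two sides, and removing it from the second side
  leaves \<open>\<Union>\<D>\<close>.\<close>

lemma osep_of_inj:
  assumes "\<D> \<subseteq> comps V E X" "\<D>' \<subseteq> comps V E X'" "osep_of V E X \<D> = osep_of V E X' \<D>'"
  shows "X = X' \<and> \<D> = \<D>'"
proof -
  have X: "X = X'" using osep_of_Int[OF assms(1)] osep_of_Int[OF assms(2)] assms(3) by simp
  have "X \<inter> \<Union>\<D> = {}" "X \<inter> \<Union>\<D>' = {}"
    using assms(1,2) comps_subset[of _ V E X] unfolding X by blast+
  then have "\<Union>\<D> = \<Union>\<D>'" using assms(3) unfolding X osep_of_def by blast
  then show ?thesis using X comps_Union_inj[OF assms(1)] assms(2) by blast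
qed

lemma osep_of_lift:
  assumes XX: "X \<subseteq> X'" and D: "\<D> \<subseteq> comps V E X"
  shows "osep_of V E X' (lift_comps V E X' \<D>) =
    (fst (osep_of V E X \<D>) \<union> X', snd (osep_of V E X \<D>) \<union> X')"
  unfolding osep_of_def lift_comps_compl[OF XX D, symmetric]
  using XX D by (auto simp: Union_lift_comps[OF XX])

text \<open>An edge between the two strict sides would join distinct components of
  \<open>G - X\<close>.\<close>

lemma osep_of_crit_seps:
  assumes X: "X \<in> finsubs V" and D: "\<D> \<in> unsplit_sets V E X"
  shows "{fst (osep_of V E X \<D>), snd (osep_of V E X \<D>)} \<in> crit_seps V E"
proof -
  let ?A = "fst (osep_of V E X \<D>)" and ?B = "snd (osep_of V E X \<D>)"
  have Dsub: "\<D> \<subseteq> comps V E X" using D by (rule unsplit_sets_subset)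
  have X': "X \<subseteq> V" "finite X" using X by (auto simp: finsubs_def)
  have "{a, b} \<notin> E" if "a \<in> ?A - ?B" "b \<in> ?B - ?A" for a b
  proof
    assume e: "{a, b} \<in> E"
    have "a \<in> \<Union>(comps V E X - \<D>)" "b \<in> \<Union>\<D>" using that unfolding osep_of_def by auto
    then obtain P Q where P: "P \<in> comps V E X" "a \<in> P" "P \<notin> \<D>" and Q: "Q \<in> \<D>" "b \<in> Q"
      by blast
    have "b \<in> V - X" using Q Dsub comps_subset[of Q V E X] by blast
    then have "b \<in> P" using comps_adjacent[OF P(1,2)] e by blast
    then have "P = Q" using comps_eqI[OF P(1), of Q] Q Dsub by blast
    then show False using P Q by simp
  qed
  then have fo: "{?A, ?B} \<in> finite_order_seps V E"
    unfolding finite_order_seps_def mem_Collect_eq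
    by (intro exI[of _ ?A] exI[of _ ?B])
      (simp add: osep_of_Un[OF Dsub X'(1)] osep_of_Int[OF Dsub] X'(2))
  have "comps_at V E X Y - \<D> = comps_at V E X Y \<inter> (comps V E X - \<D>)" for Y
    by (auto simp: comps_at_def)
  then have "\<not> (\<exists>Y\<in>crit V E X. infinite (comps_at V E X Y \<inter> (comps V E X - \<D>)) \<and>
      infinite (comps_at V E X Y \<inter> \<D>))"
    using D by (auto simp: unsplit_sets_def)
  moreover have "{?A, ?B} = {X \<union> \<Union>(comps V E X - \<D>), X \<union> \<Union>\<D>}"
    by (simp add: osep_of_def Un_commute)
  moreover have "(comps V E X - \<D>) \<union> \<D> = comps V E X" using Dsub by blast
  ultimately show ?thesis using fo X unfolding crit_seps_def by blast
qed

lemma crit_seps_osep_of: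
  assumes "s \<in> crit_seps V E"
  obtains X \<D> where "X \<in> finsubs V" "\<D> \<in> unsplit_sets V E X"
    "s = {fst (osep_of V E X \<D>), snd (osep_of V E X \<D>)}"
proof -
  obtain X \<C> \<D> where X: "X \<in> finsubs V" and p: "\<C> \<union> \<D> = comps V E X" "\<C> \<inter> \<D> = {}"
    and ns: "\<not> (\<exists>Y\<in>crit V E X. infinite (comps_at V E X Y \<inter> \<C>) \<and> infinite (comps_at V E X Y \<inter> \<D>))"
    and s: "s = {X \<union> \<Union>\<C>, X \<union> \<Union>\<D>}"
    using assms unfolding crit_seps_def mem_Collect_eq by (elim conjE bexE exE) (rule that)
  have C: "\<C> = comps V E X - \<D>" using p by blast
  have "comps_at V E X Y \<inter> \<C> = comps_at V E X Y - \<D>" for Y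
    unfolding C by (auto simp: comps_at_def)
  then have "\<D> \<in> unsplit_sets V E X" using p ns by (auto simp: unsplit_sets_def)
  moreover have "s = {fst (osep_of V E X \<D>), snd (osep_of V E X \<D>)}"
    using s C by (simp add: osep_of_def Un_commute)
  ultimately show thesis using that X by blast
qed

lemma orientations_osep_of:
  assumes "\<D> \<subseteq> comps V E X"
  shows "orientations {fst (osep_of V E X \<D>), snd (osep_of V E X \<D>)} =
    {osep_of V E X \<D>, osep_of V E X (comps V E X - \<D>)}"
  unfolding swap_osep_of[OF assms, symmetric]
  by (cases "osep_of V E X \<D>") (auto simp: orientations_def doubleton_eq_iff)

text \<open>Complements of unsplit sets are unsplit, so both orientations of a separation are of the
  form \<open>osep_of\<close>.\<close>

lemma orientations_crit_seps:
  "(\<Union>s\<in>crit_seps V E. orientations s) =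
    {osep_of V E X \<D> | X \<D>. X \<in> finsubs V \<and> \<D> \<in> unsplit_sets V E X}" (is "?L = ?R")
proof
  show "?L \<subseteq> ?R"
  proof
    fix r assume "r \<in> ?L"
    then obtain s where s: "s \<in> crit_seps V E" "r \<in> orientations s" by blast
    obtain X \<D> where X: "X \<in> finsubs V" "\<D> \<in> unsplit_sets V E X"
      "s = {fst (osep_of V E X \<D>), snd (osep_of V E X \<D>)}"
      using crit_seps_osep_of[OF s(1)] .
    then have "r = osep_of V E X \<D> \<or> r = osep_of V E X (comps V E X - \<D>)"
      using s(2) orientations_osep_of[OF unsplit_sets_subset[OF X(2)]] by simp
    then show "r \<in> ?R" using X unsplit_sets_compl[OF X(2)] by blast
  qed
  show "?R \<subseteq> ?L"
  proof
    fix r assume "r \<in> ?R"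
    then obtain X \<D> where X: "r = osep_of V E X \<D>" "X \<in> finsubs V" "\<D> \<in> unsplit_sets V E X"
      by blast
    then have "r \<in> orientations {fst (osep_of V E X \<D>), snd (osep_of V E X \<D>)}"
      using orientations_osep_of[OF unsplit_sets_subset] by blast
    then show "r \<in> ?L" using osep_of_crit_seps[OF X(2,3)] by blast
  qed
qed


section \<open>From tangles to limits\<close>

locale crit_tangle =
  fixes V :: "'a set" and E :: "'a set set" and \<tau> :: "'a osep set"
  assumes tangle: "aleph0_tangle (crit_seps V E) \<tau>"
begin

lemma oseps: "\<tau> \<subseteq> {osep_of V E X \<D> | X \<D>. X \<in> finsubs V \<and> \<D> \<in> unsplit_sets V E X}"
  using tangle unfolding aleph0_tangle_def orientation_of_def orientations_crit_seps by blast

lemma no_star: "\<sigma> \<subseteq> \<tau> \<Longrightarrow> finite \<sigma> \<Longrightarrow> star \<sigma> \<Longrightarrow> infinite (star_interior \<sigma>)"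
  using tangle unfolding aleph0_tangle_def by blast

lemma finite_order:
  assumes "r \<in> \<tau>" shows "finite (fst r \<inter> snd r)"
proof -
  obtain X \<D> where "r = osep_of V E X \<D>" "X \<in> finsubs V" "\<D> \<in> unsplit_sets V E X"
    using assms oseps by blast
  then show ?thesis using osep_of_Int[OF unsplit_sets_subset, of \<D> V E X] by (simp add: finsubs_def)
qed

text \<open>The degenerate cases \<open>r = s\<close> and \<open>prod.swap r = s\<close>, which consistency leaves open, are
  excluded by the finite star \<open>{r, s}\<close>.\<close>

lemma not_pointing_apart:
  assumes r: "r \<in> \<tau>" and s: "s \<in> \<tau>" and le: "snd r \<subseteq> fst s" "snd s \<subseteq> fst r"
  shows False
proof (cases "r = s \<or> prod.swap r = s")
  case True
  have "star {r, s}" using True by (auto simp: star_def osep_le_def)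
  moreover have "star_interior {r, s} \<subseteq> fst r \<inter> snd r"
    using True le by (auto simp: star_interior_def)
  ultimately show False using no_star[of "{r, s}"] r s finite_order[OF r] finite_subset by blast
next
  case False
  then have "osep_less (prod.swap r) s" using le by (simp add: osep_less_def osep_le_def)
  then show False using tangle r s False unfolding aleph0_tangle_def consistent_def by blast
qed

section \<open>The ultrafilter that a tangle induces on the unsplit sets at one finite
  \<open>X\<close>\<close>

context
  fixes X
  assumes X: "X \<in> finsubs V"
begin

lemma tangle_sets_unsplit_sets:
  assumes "\<D> \<in> tangle_sets V E \<tau> X"
  shows "\<D> \<in> unsplit_sets V E X"
proof -
  have D: "\<D> \<subseteq> comps V E X" "osep_of V E X \<D> \<in> \<tau>" using assms by (auto simp: tangle_sets_osep_of)
  then obtain X' \<D>' where "osep_of V E X \<D> = osep_of V E X' \<D>'" "\<D>' \<in> unsplit_sets V E X'"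
    using oseps by blast
  then show ?thesis using osep_of_inj[OF D(1) unsplit_sets_subset] by blast
qed

lemma tangle_sets_total:
  assumes D: "\<D> \<in> unsplit_sets V E X"
  shows "\<D> \<in> tangle_sets V E \<tau> X \<or> comps V E X - \<D> \<in> tangle_sets V E \<tau> X"
proof -
  have sub: "\<D> \<subseteq> comps V E X" using D by (rule unsplit_sets_subset)
  have "\<exists>r. r \<in> \<tau> \<and> r \<in> orientations {fst (osep_of V E X \<D>), snd (osep_of V E X \<D>)}"
    using tangle osep_of_crit_seps[OF X D] unfolding aleph0_tangle_def orientation_of_def by blast
  then show ?thesis using sub unfolding orientations_osep_of[OF sub] by (auto simp: tangle_sets_osep_of)
qed

text \<open>Otherwise \<open>\<tau>\<close> also points towards the complement of
  \<open>\<D>\<close>, hence away from \<open>\<C>\<close>, which \<open>not_pointing_apart\<close>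
  forbids.\<close>

lemma tangle_sets_mono:
  assumes C: "\<C> \<in> tangle_sets V E \<tau> X" and D: "\<D> \<in> unsplit_sets V E X" and sub: "\<C> \<subseteq> \<D>"
  shows "\<D> \<in> tangle_sets V E \<tau> X"
proof (rule ccontr)
  assume "\<not> ?thesis"
  then have "osep_of V E X (comps V E X - \<D>) \<in> \<tau>"
    using tangle_sets_total[OF D] by (auto simp: tangle_sets_osep_of)
  moreover have "osep_of V E X \<C> \<in> \<tau>" using C by (simp add: tangle_sets_osep_of)
  ultimately show False
    by (rule not_pointing_apart) (use sub unsplit_sets_subset[OF D] in \<open>auto simp: osep_of_def\<close>)
qed

lemma empty_not_tangle_set: "{} \<notin> tangle_sets V E \<tau> X"
proof
  assume "{} \<in> tangle_sets V E \<tau> X"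
  then have "{osep_of V E X {}} \<subseteq> \<tau>" by (simp add: tangle_sets_osep_of)
  moreover have "star {osep_of V E X {}}" by (simp add: star_def)
  ultimately have "infinite (star_interior {osep_of V E X {}})" using no_star by blast
  then show False using X by (simp add: star_interior_def osep_of_def finsubs_def)
qed

lemma tangle_sets_Int_nonempty:
  assumes C: "\<C> \<in> tangle_sets V E \<tau> X" and D: "\<D> \<in> tangle_sets V E \<tau> X"
  shows "\<C> \<inter> \<D> \<noteq> {}"
proof
  assume "\<C> \<inter> \<D> = {}"
  moreover have "osep_of V E X \<C> \<in> \<tau>" "osep_of V E X \<D> \<in> \<tau>" "\<C> \<subseteq> comps V E X" "\<D> \<subseteq> comps V E X"
    using C D by (auto simp: tangle_sets_osep_of)
  ultimately show False
    by (intro not_pointing_apart[of "osep_of V E X \<C>" "osep_of V E X \<D>"]) (auto simp: osep_of_def)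
qed

text \<open>Were the intersection not chosen, \<open>\<tau>\<close> would contain three separations
  whose small sides, apart from \<open>X\<close>, partition \<open>V - X\<close>: a finite star with
  interior inside \<open>X\<close>.\<close>

lemma tangle_sets_Int:
  assumes C: "\<C> \<in> tangle_sets V E \<tau> X" and D: "\<D> \<in> tangle_sets V E \<tau> X"
  shows "\<C> \<inter> \<D> \<in> tangle_sets V E \<tau> X"
proof (rule ccontr)
  assume neg: "\<not> ?thesis"
  let ?K = "comps V E X"
  \<comment> \<open>The complements of \<open>\<C>\<close>, \<open>?P\<close> and \<open>?Q\<close>
    are \<open>?K - \<C>\<close>, \<open>\<C> - \<D>\<close> and \<open>\<C> \<inter> \<D>\<close>,
    which partition \<open>?K\<close>. So any two of the three sets cover \<open>?K\<close>, and all
    three have empty intersection.\<close>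
  let ?P = "?K - (\<C> \<inter> (?K - \<D>))" and ?Q = "?K - \<C> \<inter> \<D>"
  let ?o = "osep_of V E X"
  have us: "\<C> \<in> unsplit_sets V E X" "\<D> \<in> unsplit_sets V E X"
    using C D tangle_sets_unsplit_sets by blast+
  have sub: "\<C> \<subseteq> ?K" "\<D> \<subseteq> ?K" using us unsplit_sets_subset by blast+
  have Q: "?Q \<in> tangle_sets V E \<tau> X"
    using tangle_sets_total[OF unsplit_sets_Int[OF us]] neg by blast
  \<comment> \<open>\<open>?P\<close> is chosen because it contains \<open>\<D>\<close>.\<close>
  have P: "?P \<in> tangle_sets V E \<tau> X"
    by (rule tangle_sets_mono[OF D]) (use us sub in \<open>blast intro: unsplit_sets_compl unsplit_sets_Int\<close>)+
  have le: "osep_le (?o \<A>) (prod.swap (?o \<B>))" if "\<A> \<subseteq> ?K" "\<B> \<subseteq> ?K" "\<A> \<union> \<B> = ?K" for \<A> \<B>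
    using that by (auto simp: osep_le_def osep_of_def)
  let ?\<sigma> = "{?o \<C>, ?o ?P, ?o ?Q}"
  have "\<C> \<union> ?P = ?K" "\<C> \<union> ?Q = ?K" "?P \<union> ?Q = ?K" "?P \<union> \<C> = ?K" "?Q \<union> \<C> = ?K" "?Q \<union> ?P = ?K"
    using sub by blast+
  then have "star ?\<sigma>" using sub by (auto simp: star_def intro!: le)
  moreover have "?\<sigma> \<subseteq> \<tau>" using C P Q by (auto simp: tangle_sets_osep_of)
  ultimately have "infinite (star_interior ?\<sigma>)" using no_star by blast
  moreover have "star_interior ?\<sigma> \<subseteq> X"
  proof
    fix v assume v: "v \<in> star_interior ?\<sigma>"
    show "v \<in> X"
    proof (rule ccontr)
      assume "v \<notin> X"
      then obtain A B D where "A \<in> \<C>" "B \<in> ?P" "D \<in> ?Q" "v \<in> A" "v \<in> B" "v \<in> D"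
        using v by (auto simp: star_interior_def osep_of_def)
      moreover from this have "A = B" "A = D" using comps_eqI[of A V E X _ v] sub by blast+
      ultimately show False by blast
    qed
  qed
  ultimately show False using X finite_subset by (auto simp: finsubs_def)
qed

text \<open>Phrased as the complement of a union so that the empty family gives
  \<open>comps V E X\<close> rather than \<open>UNIV\<close>.\<close>

lemma tangle_sets_finite_Inter:
  assumes "finite I" "\<And>i. i \<in> I \<Longrightarrow> comps V E X - \<F> i \<in> tangle_sets V E \<tau> X"
  shows "comps V E X - (\<Union>i\<in>I. \<F> i) \<in> tangle_sets V E \<tau> X"
  using assms
proof (induction I)
  case empty
  show ?case using tangle_sets_total[OF unsplit_sets_comps] empty_not_tangle_set by simp
next
  case (insert i I)
  have "comps V E X - (\<Union>i\<in>insert i I. \<F> i) = (comps V E X - \<F> i) \<inter> (comps V E X - (\<Union>i\<in>I. \<F> i))"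
    by blast
  then show ?case using insert tangle_sets_Int by simp
qed

lemma tangle_filter_principal:
  assumes C: "{C} \<in> tangle_sets V E \<tau> X"
  shows "tangle_filter V E \<tau> X = principal_uf V E X C"
proof -
  have "C \<in> \<D>" if "\<D> \<in> tangle_sets V E \<tau> X" for \<D>
    using tangle_sets_Int_nonempty[OF C that] by blast
  then show ?thesis using C by (auto simp: tangle_filter_def principal_uf_def)
qed

text \<open>A chosen set with finite trace on \<open>comps_at V E X Y\<close> would miss the rest of
  \<open>comps_at V E X Y\<close>, which is chosen by \<open>cof\<close>. So the trace is infinite,
  and being unsplit makes it cofinite.\<close>

lemma tangle_filter_crit:
  assumes Y: "Y \<in> crit V E X"
    and cof: "\<And>\<D>. \<D> \<subseteq> comps_at V E X Y \<Longrightarrow> finite (comps_at V E X Y - \<D>) \<Longrightarrow>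
      \<D> \<in> tangle_sets V E \<tau> X"
  shows "tangle_filter V E \<tau> X = crit_filter V E X Y"
proof
  show "crit_filter V E X Y \<subseteq> tangle_filter V E \<tau> X"
    using cof unfolding crit_filter_def tangle_filter_def by blast
  show "tangle_filter V E \<tau> X \<subseteq> crit_filter V E X Y"
  proof
    fix \<C> assume "\<C> \<in> tangle_filter V E \<tau> X"
    then obtain \<D> where D: "\<C> \<subseteq> comps V E X" "\<D> \<in> tangle_sets V E \<tau> X" "\<D> \<subseteq> \<C>"
      by (auto simp: tangle_filter_def)
    have "infinite (comps_at V E X Y \<inter> \<D>)"
    proof
      assume fin: "finite (comps_at V E X Y \<inter> \<D>)"
      have "comps_at V E X Y - \<D> \<in> tangle_sets V E \<tau> X"
        by (rule cof) (use fin in \<open>auto simp: Diff_Diff_Int\<close>)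
      then show False using tangle_sets_Int_nonempty[OF D(2)] by blast
    qed
    then have "finite (comps_at V E X Y - \<D>)"
      using tangle_sets_unsplit_sets[OF D(2)] Y by (auto simp: unsplit_sets_def)
    moreover have "comps_at V E X Y - comps_at V E X Y \<inter> \<D> = comps_at V E X Y - \<D>" by blast
    ultimately show "\<C> \<in> crit_filter V E X Y"
      unfolding crit_filter_def mem_Collect_eq using D
      by (intro conjI exI[of _ "comps_at V E X Y \<inter> \<D>"]) auto
  qed
qed

text \<open>If no singleton is chosen, all cofinite sets are. Neighbourhoods of components lie in
  the finite set \<open>X\<close>, so finitely many sets \<open>comps_at V E X Y\<close> cover all
  components and one of them is chosen; intersecting it with cofinite sets gives its cofinite
  subsets.\<close>

lemma tangle_sets_classification:
  obtains (principal) C where "C \<in> comps V E X" "{C} \<in> tangle_sets V E \<tau> X"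
  | (crit) Y where "Y \<in> crit V E X"
      "\<And>\<D>. \<D> \<subseteq> comps_at V E X Y \<Longrightarrow> finite (comps_at V E X Y - \<D>) \<Longrightarrow> \<D> \<in> tangle_sets V E \<tau> X"
proof (cases "\<exists>C\<in>comps V E X. {C} \<in> tangle_sets V E \<tau> X")
  case True
  then show thesis using principal by blast
next
  case False
  let ?K = "comps V E X"
  have cofin: "?K - \<F> \<in> tangle_sets V E \<tau> X" if F: "finite \<F>" "\<F> \<subseteq> ?K" for \<F>
  proof -
    have "?K - {C} \<in> tangle_sets V E \<tau> X" if "C \<in> \<F>" for C
      using tangle_sets_total[OF unsplit_sets_finite[of "{C}"]] that F False by blast
    then show ?thesis using tangle_sets_finite_Inter[OF F(1), of "\<lambda>C. {C}"] by simp
  qed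
  have "\<exists>Y\<in>Pow X. comps_at V E X Y \<in> tangle_sets V E \<tau> X"
  proof (rule ccontr)
    assume "\<not> ?thesis"
    then have "?K - comps_at V E X Y \<in> tangle_sets V E \<tau> X" if "Y \<in> Pow X" for Y
      using tangle_sets_total[OF comps_at_unsplit] that by blast
    moreover have "finite (Pow X)" using X by (simp add: finsubs_def)
    ultimately have "?K - (\<Union>Y\<in>Pow X. comps_at V E X Y) \<in> tangle_sets V E \<tau> X"
      by (intro tangle_sets_finite_Inter)
    moreover have "?K - (\<Union>Y\<in>Pow X. comps_at V E X Y) = {}"
      using nbhd_comps by (fastforce simp: comps_at_def)
    ultimately show False using empty_not_tangle_set by simp
  qed
  then obtain Y where Y: "Y \<subseteq> X" "comps_at V E X Y \<in> tangle_sets V E \<tau> X" by blast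
  have sub: "comps_at V E X Y \<subseteq> ?K" by (auto simp: comps_at_def)
  have cof: "\<D> \<in> tangle_sets V E \<tau> X"
    if "\<D> \<subseteq> comps_at V E X Y" "finite (comps_at V E X Y - \<D>)" for \<D>
  proof (subst cofinite_comps_at_eq[OF that(1)], rule tangle_sets_Int[OF Y(2) cofin[OF that(2)]])
    show "comps_at V E X Y - \<D> \<subseteq> ?K" using sub by blast
  qed
  \<comment> \<open>If it were finite, the empty set would be one of its cofinite subsets and thus
    be chosen.\<close>
  have "infinite (comps_at V E X Y)"
    using cof[of "{}"] empty_not_tangle_set by auto
  then have "Y \<in> crit V E X" using Y by (simp add: crit_def)
  then show thesis using crit cof by blast
qed

lemma tangle_filter_in_filters_at: "tangle_filter V E \<tau> X \<in> filters_at V E X"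
  by (cases rule: tangle_sets_classification)
    (use tangle_filter_principal tangle_filter_crit in \<open>auto simp: filters_at_def\<close>)

text \<open>Passing to the filter loses nothing: closing upwards adds no new unsplit set, by
  \<open>tangle_sets_mono\<close>.\<close>

lemma tangle_sets_eq: "tangle_sets V E \<tau> X = tangle_filter V E \<tau> X \<inter> unsplit_sets V E X"
proof
  show "tangle_sets V E \<tau> X \<subseteq> tangle_filter V E \<tau> X \<inter> unsplit_sets V E X"
    using tangle_sets_unsplit_sets by (auto simp: tangle_filter_def tangle_sets_def)
  show "tangle_filter V E \<tau> X \<inter> unsplit_sets V E X \<subseteq> tangle_sets V E \<tau> X"
    using tangle_sets_mono by (auto simp: tangle_filter_def)
qed

text \<open>The lift enlarges both sides and is in general not comparable with
  \<open>(A, B)\<close>, so a separation enlarging only \<open>B\<close> mediates between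
  them.\<close>

lemma tangle_sets_lift:
  assumes X': "X' \<in> finsubs V" and XX: "X \<subseteq> X'" and D: "\<D> \<in> tangle_sets V E \<tau> X"
  shows "lift_comps V E X' \<D> \<in> tangle_sets V E \<tau> X'"
proof (rule ccontr)
  assume neg: "\<not> ?thesis"
  have us: "\<D> \<in> unsplit_sets V E X" using D by (rule tangle_sets_unsplit_sets)
  have sub: "\<D> \<subseteq> comps V E X" using us by (rule unsplit_sets_subset)
  define A B where "A = fst (osep_of V E X \<D>)" and "B = snd (osep_of V E X \<D>)"
  have AB: "(A, B) \<in> \<tau>" using D by (simp add: A_def B_def tangle_sets_osep_of)
  have V: "A \<union> B = V" using osep_of_Un[OF sub] X by (simp add: A_def B_def finsubs_def)
  have int: "A \<inter> B = X" using osep_of_Int[OF sub] by (simp add: A_def B_def)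
  \<comment> \<open>Adding \<open>Z\<close> to both sides gives the separation of the lifted set at
    \<open>Z\<close>, which again belongs to the system.\<close>
  have oriented: "(A \<union> Z, B \<union> Z) \<in> \<tau> \<or> (B \<union> Z, A \<union> Z) \<in> \<tau>" if "X \<subseteq> Z" "Z \<in> finsubs V" for Z
  proof -
    have us': "lift_comps V E Z \<D> \<in> unsplit_sets V E Z" by (rule lift_comps_unsplit[OF that(1) us])
    have "\<exists>r. r \<in> \<tau> \<and> r \<in> orientations {fst (osep_of V E Z (lift_comps V E Z \<D>)),
        snd (osep_of V E Z (lift_comps V E Z \<D>))}"
      using tangle osep_of_crit_seps[OF that(2) us']
      unfolding aleph0_tangle_def orientation_of_def by blast
    then show ?thesis
      by (auto simp: osep_of_lift[OF that(1) sub] A_def B_def orientations_def doubleton_eq_iff)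
  qed
  have X'V: "X' \<subseteq> V" "finite X'" using X' by (auto simp: finsubs_def)
  \<comment> \<open>The separator of the mediating separation: it lies inside \<open>A\<close>, and
    adding it to \<open>B\<close> adds all of \<open>X'\<close>, since \<open>A\<close> and
    \<open>B\<close> cover \<open>V\<close>.\<close>
  have X1: "A \<union> (X \<union> X' \<inter> A) = A" "B \<union> (X \<union> X' \<inter> A) = B \<union> X'" "X \<union> X' \<inter> A \<in> finsubs V"
    using X'V X V int by (auto simp: finsubs_def)
  have "(B \<union> X', A) \<notin> \<tau>" using not_pointing_apart[OF AB, of "(B \<union> X', A)"] by auto
  then have r: "(A, B \<union> X') \<in> \<tau>" using oriented[OF _ X1(3)] X1 by simp
  have "osep_of V E X' (lift_comps V E X' \<D>) \<notin> \<tau>"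
    using neg by (auto simp: tangle_sets_osep_of lift_comps_def)
  then have s: "(B \<union> X', A \<union> X') \<in> \<tau>"
    using oriented[OF XX X'] by (simp add: osep_of_lift[OF XX sub] A_def B_def)
  let ?\<sigma> = "{(A, B \<union> X'), (B \<union> X', A \<union> X')}"
  have "star ?\<sigma>" by (auto simp: star_def osep_le_def)
  moreover have "star_interior ?\<sigma> \<subseteq> X'" using int XX by (auto simp: star_interior_def)
  ultimately show False using no_star[of ?\<sigma>] r s X'V finite_subset by blast
qed

end

text \<open>For the converse, if the complement of \<open>\<D>\<close> were chosen, its lift would
  be a chosen set disjoint from the lift of \<open>\<D>\<close>.\<close>

lemma tangle_sets_lift_iff:
  assumes X: "X \<in> finsubs V" and X': "X' \<in> finsubs V" and XX: "X \<subseteq> X'"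
    and D: "\<D> \<in> unsplit_sets V E X"
  shows "lift_comps V E X' \<D> \<in> tangle_sets V E \<tau> X' \<longleftrightarrow> \<D> \<in> tangle_sets V E \<tau> X"
proof
  assume L: "lift_comps V E X' \<D> \<in> tangle_sets V E \<tau> X'"
  show "\<D> \<in> tangle_sets V E \<tau> X"
  proof (rule ccontr)
    assume "\<D> \<notin> tangle_sets V E \<tau> X"
    then have "comps V E X - \<D> \<in> tangle_sets V E \<tau> X" using tangle_sets_total[OF X D] by blast
    then have "comps V E X' - lift_comps V E X' \<D> \<in> tangle_sets V E \<tau> X'"
      using tangle_sets_lift[OF X X' XX] lift_comps_compl[OF XX unsplit_sets_subset[OF D]] by metis
    then show False using tangle_sets_Int_nonempty[OF X' L] by blast
  qed
qed (rule tangle_sets_lift[OF X X' XX])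

text \<open>The tangle is classified at \<open>X'\<close>. In each case \<open>descend\<close>
  carries generators found there to generators of the expected filter at \<open>X\<close>.\<close>

lemma bond_tangle_filter:
  assumes X: "X \<in> finsubs V" and X': "X' \<in> finsubs V" and XX: "X \<subseteq> X'"
  shows "bond V E X' X (tangle_filter V E \<tau> X') = tangle_filter V E \<tau> X"
proof -
  have descend: "\<D> \<in> tangle_sets V E \<tau> X"
    if "\<D> \<in> unsplit_sets V E X" "\<C> \<in> tangle_sets V E \<tau> X'" "\<C> \<subseteq> lift_comps V E X' \<D>" for \<C> \<D>
    using tangle_sets_mono[OF X' that(2) lift_comps_unsplit[OF XX that(1)] that(3)]
      tangle_sets_lift_iff[OF X X' XX that(1)] by blast
  show ?thesis
  proof (cases rule: tangle_sets_classification[OF X'])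
    case (1 C')
    obtain C where C: "C \<in> comps V E X" "C' \<subseteq> C" using comps_contained[OF XX 1(1)] .
    have "{C} \<in> tangle_sets V E \<tau> X"
      by (rule descend[OF _ 1(2)])
        (use C 1 in \<open>auto simp: lift_comps_def intro: unsplit_sets_finite\<close>)
    then show ?thesis
      using tangle_filter_principal[OF X] tangle_filter_principal[OF X' 1(2)]
        bond_principal_uf[OF 1(1)] comp_map_eq[OF 1(1) C] by metis
  next
    case (2 Y)
    have bond: "bond V E X' X (tangle_filter V E \<tau> X') = (if Y \<subseteq> X then crit_filter V E X Y
        else principal_uf V E X (THE C. C \<in> comps V E X \<and> \<Union>(comps_at V E X' Y) \<subseteq> C))"
      using tangle_filter_crit[OF X' 2] bond_crit_filter[OF 2(1)] by metis
    show ?thesis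
    proof (cases "Y \<subseteq> X")
      case True
      have "\<D> \<in> tangle_sets V E \<tau> X"
        if D: "\<D> \<subseteq> comps_at V E X Y" "finite (comps_at V E X Y - \<D>)" for \<D>
      proof (rule descend)
        show "\<D> \<in> unsplit_sets V E X" using cofinite_comps_at_unsplit[OF D] .
        have "finite (comps_at V E X' Y - \<D>)"
          by (rule finite_subset[OF _ D(2)]) (use comps_at_mono[OF XX True, of V E] in blast)
        then show "comps_at V E X' Y \<inter> \<D> \<in> tangle_sets V E \<tau> X'"
          by (intro 2(2)) (auto simp: Diff_Int)
        show "comps_at V E X' Y \<inter> \<D> \<subseteq> lift_comps V E X' \<D>"
          by (auto simp: lift_comps_def comps_at_def)
      qed
      then show ?thesis using tangle_filter_crit[OF X crit_mono[OF XX True 2(1)]] bond True by simp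
    next
      case False
      have "comps_at V E X' Y \<noteq> {}" using 2(1) by (auto simp: crit_def)
      then obtain C where C: "C \<in> comps V E X" "\<Union>(comps_at V E X' Y) \<subseteq> C"
        "(THE C. C \<in> comps V E X \<and> \<Union>(comps_at V E X' Y) \<subseteq> C) = C"
        by (rule comps_at_in_one_comp[OF XX False])
      have "{C} \<in> tangle_sets V E \<tau> X"
      proof (rule descend)
        show "{C} \<in> unsplit_sets V E X" using C(1) by (simp add: unsplit_sets_finite)
        show "comps_at V E X' Y \<in> tangle_sets V E \<tau> X'" by (rule 2(2)) auto
        show "comps_at V E X' Y \<subseteq> lift_comps V E X' {C}"
          using C(2) by (auto simp: lift_comps_def comps_at_def)
      qed
      then show ?thesis using tangle_filter_principal[OF X] bond False C(3) by simp
    qed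
  qed
qed

lemma tangle_filter_in_inverse_limit:
  "(\<lambda>X\<in>finsubs V. tangle_filter V E \<tau> X) \<in> inverse_limit V E"
  using tangle_filter_in_filters_at bond_tangle_filter by (auto simp: inverse_limit_def)

text \<open>Recovers a tangle from its filters at the finite sets, which yields injectivity.\<close>

lemma tangle_eq_oseps:
  "\<tau> = {osep_of V E X \<D> | X \<D>. X \<in> finsubs V \<and> \<D> \<in> tangle_filter V E \<tau> X \<inter> unsplit_sets V E X}"
    (is "_ = ?R")
proof
  show "\<tau> \<subseteq> ?R"
  proof
    fix r assume r: "r \<in> \<tau>"
    then obtain X \<D> where X: "r = osep_of V E X \<D>" "X \<in> finsubs V" "\<D> \<in> unsplit_sets V E X"
      using oseps by blast
    then have "\<D> \<in> tangle_sets V E \<tau> X"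
      using r unsplit_sets_subset[OF X(3)] by (simp add: tangle_sets_osep_of)
    then show "r \<in> ?R" using X tangle_sets_eq[OF X(2)] by blast
  qed
  show "?R \<subseteq> \<tau>"
  proof
    fix r assume "r \<in> ?R"
    then obtain X \<D> where "r = osep_of V E X \<D>" "\<D> \<in> tangle_sets V E \<tau> X"
      using tangle_sets_eq by blast
    then show "r \<in> \<tau>" by (simp add: tangle_sets_osep_of)
  qed
qed

end


section \<open>From limits to tangles\<close>

lemma filters_at_cases:
  assumes "\<U> \<in> filters_at V E X"
  obtains (principal) C where "C \<in> comps V E X" "\<U> = principal_uf V E X C"
  | (crit) Y where "Y \<in> crit V E X" "\<U> = crit_filter V E X Y"
  using assms by (auto simp: filters_at_def)

text \<open>The trace \<open>comps_at V E X Y \<inter> \<C>\<close> is the largest possible witness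
  \<open>\<D>\<close> in the definition.\<close>

lemma crit_filter_iff:
  "\<C> \<in> crit_filter V E X Y \<longleftrightarrow> \<C> \<subseteq> comps V E X \<and> finite (comps_at V E X Y - \<C>)"
proof
  assume "\<C> \<in> crit_filter V E X Y"
  then obtain \<D> where "\<C> \<subseteq> comps V E X" "finite (comps_at V E X Y - \<D>)" "\<D> \<subseteq> \<C>"
    by (auto simp: crit_filter_def)
  moreover from this have "comps_at V E X Y - \<C> \<subseteq> comps_at V E X Y - \<D>" by blast
  ultimately show "\<C> \<subseteq> comps V E X \<and> finite (comps_at V E X Y - \<C>)" using finite_subset by blast
next
  assume "\<C> \<subseteq> comps V E X \<and> finite (comps_at V E X Y - \<C>)"
  then show "\<C> \<in> crit_filter V E X Y"
    unfolding crit_filter_def mem_Collect_eq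
    by (intro conjI exI[of _ "comps_at V E X Y \<inter> \<C>"]) (auto simp: Diff_Int)
qed

lemma filters_at_Int:
  assumes "\<U> \<in> filters_at V E X" "\<C> \<in> \<U>" "\<D> \<in> \<U>"
  shows "\<C> \<inter> \<D> \<in> \<U>"
  using assms(1)
  by (cases rule: filters_at_cases)
    (use assms in \<open>auto simp: principal_uf_def crit_filter_iff Diff_Int\<close>)

lemma filters_at_subset: "\<U> \<in> filters_at V E X \<Longrightarrow> \<C> \<in> \<U> \<Longrightarrow> \<C> \<subseteq> comps V E X"
  by (auto simp: filters_at_def principal_uf_def crit_filter_def)

lemma filters_at_empty: "\<U> \<in> filters_at V E X \<Longrightarrow> {} \<notin> \<U>"
  by (auto simp: filters_at_def principal_uf_def crit_filter_iff crit_def)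

text \<open>A filter \<open>crit_filter V E X Y\<close> decides only sets that do not divide
  \<open>comps_at V E X Y\<close> into two infinite parts; unsplit sets are among these.\<close>

lemma filters_at_compl_iff:
  assumes U: "\<U> \<in> filters_at V E X" and D: "\<D> \<in> unsplit_sets V E X"
  shows "comps V E X - \<D> \<in> \<U> \<longleftrightarrow> \<D> \<notin> \<U>"
proof
  assume "comps V E X - \<D> \<in> \<U>"
  then have "(comps V E X - \<D>) \<inter> \<D> \<in> \<U>" if "\<D> \<in> \<U>" using filters_at_Int[OF U] that by blast
  moreover have "(comps V E X - \<D>) \<inter> \<D> = {}" by blast
  ultimately show "\<D> \<notin> \<U>" using filters_at_empty[OF U] by auto
next
  assume nD: "\<D> \<notin> \<U>"
  have sub: "\<D> \<subseteq> comps V E X" using D by (rule unsplit_sets_subset)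
  from U show "comps V E X - \<D> \<in> \<U>"
  proof (cases rule: filters_at_cases)
    case (principal C)
    then show ?thesis using nD sub by (auto simp: principal_uf_def)
  next
    case (crit Y)
    then have "finite (comps_at V E X Y \<inter> \<D>)"
      using nD D sub by (auto simp: crit_filter_iff unsplit_sets_def)
    moreover have "comps_at V E X Y - (comps V E X - \<D>) = comps_at V E X Y \<inter> \<D>"
      by (auto simp: comps_at_def)
    ultimately show ?thesis using crit by (simp add: crit_filter_iff)
  qed
qed

text \<open>Unsplit members generate the filter: below a given member \<open>\<C>\<close> there is
  \<open>{C}\<close> in the principal case and \<open>comps_at V E X Y \<inter> \<C>\<close> in the
  critical case.\<close>

lemma filters_at_unsplit_base:
  assumes U: "\<U> \<in> filters_at V E X"
  shows "{\<C>. \<C> \<subseteq> comps V E X \<and> (\<exists>\<D>\<in>\<U> \<inter> unsplit_sets V E X. \<D> \<subseteq> \<C>)} = \<U>" (is "?L = _")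
proof
  show "?L \<subseteq> \<U>"
    using U by (cases rule: filters_at_cases)
      (auto simp: principal_uf_def crit_filter_iff elim!: finite_subset[rotated])
  show "\<U> \<subseteq> ?L"
  proof
    fix \<C> assume C: "\<C> \<in> \<U>"
    from U show "\<C> \<in> ?L"
    proof (cases rule: filters_at_cases)
      case (principal C)
      have "{C} \<in> \<U> \<inter> unsplit_sets V E X"
        using principal by (auto simp: principal_uf_def intro: unsplit_sets_finite)
      moreover have "{C} \<subseteq> \<C>" "\<C> \<subseteq> comps V E X" using C principal by (auto simp: principal_uf_def)
      ultimately show ?thesis by blast
    next
      case (crit Y)
      then have C': "\<C> \<subseteq> comps V E X" "finite (comps_at V E X Y - \<C>)"
        using C by (auto simp: crit_filter_iff)
      then have "finite (comps_at V E X Y - comps_at V E X Y \<inter> \<C>)" by (simp add: Diff_Int)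
      then have "comps_at V E X Y \<inter> \<C> \<in> \<U> \<inter> unsplit_sets V E X"
        using crit C' cofinite_comps_at_unsplit[of "comps_at V E X Y \<inter> \<C>" V E X Y]
        by (auto simp: crit_filter_iff)
      then show ?thesis using C' by blast
    qed
  qed
qed

text \<open>Turns the bonding map into preimages: members of the image filter pull back to members
  of \<open>\<U>\<close>.\<close>

lemma bond_lift:
  assumes XX: "X \<subseteq> X'" and U: "\<U> \<in> filters_at V E X'"
    and D: "\<D> \<in> bond V E X' X \<U>" "\<D> \<subseteq> comps V E X"
  shows "lift_comps V E X' \<D> \<in> \<U>"
  using U
proof (cases rule: filters_at_cases)
  case (principal C')
  obtain C where C: "C \<in> comps V E X" "C' \<subseteq> C" using comps_contained[OF XX principal(1)] .
  have "C \<in> \<D>"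
    using D(1) unfolding principal(2) bond_principal_uf[OF principal(1)] comp_map_eq[OF principal(1) C]
    by (simp add: principal_uf_def)
  then show ?thesis using principal C by (auto simp: principal_uf_def lift_comps_def)
next
  case (crit Y)
  note bond = bond_crit_filter[OF crit(1), of X]
  have "finite (comps_at V E X' Y - lift_comps V E X' \<D>)"
  proof (cases "Y \<subseteq> X")
    case True
    have "finite (comps_at V E X Y - \<D>)"
      using D(1) True unfolding crit(2) bond by (simp add: crit_filter_iff)
    moreover have "comps_at V E X' Y - lift_comps V E X' \<D> \<subseteq> comps_at V E X Y - \<D>"
      using comps_at_mono[OF XX True, of V E] lift_comps_comps_at[OF XX True D(2)] by blast
    ultimately show ?thesis using finite_subset by blast
  next
    case False
    have "comps_at V E X' Y \<noteq> {}" using crit(1) by (auto simp: crit_def)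
    then obtain C where C: "C \<in> comps V E X" "\<Union>(comps_at V E X' Y) \<subseteq> C"
      "(THE C. C \<in> comps V E X \<and> \<Union>(comps_at V E X' Y) \<subseteq> C) = C"
      by (rule comps_at_in_one_comp[OF XX False])
    have "C \<in> \<D>" using D(1) False C(3) unfolding crit(2) bond by (simp add: principal_uf_def)
    then have "comps_at V E X' Y - lift_comps V E X' \<D> = {}"
      using C(2) by (auto simp: lift_comps_def comps_at_def)
    then show ?thesis by (metis finite.emptyI)
  qed
  then show ?thesis using crit by (auto simp: crit_filter_iff lift_comps_def)
qed

section \<open>The tangle defined by a limit point\<close>

locale limit_point =
  fixes V :: "'a set" and E :: "'a set set" and \<Phi> :: "'a set \<Rightarrow> 'a set set set"
  assumes limit: "\<Phi> \<in> inverse_limit V E"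
begin

text \<open>Restricted to unsplit sets because a member of \<open>\<Phi> X\<close> may split a
  critical set, and then its separation is outside the system.\<close>

definition oseps where
  "oseps = {osep_of V E X \<D> | X \<D>. X \<in> finsubs V \<and> \<D> \<in> \<Phi> X \<inter> unsplit_sets V E X}"

lemma filters: "X \<in> finsubs V \<Longrightarrow> \<Phi> X \<in> filters_at V E X"
  using limit by (auto simp: inverse_limit_def)

lemma bond: "X \<in> finsubs V \<Longrightarrow> X' \<in> finsubs V \<Longrightarrow> X \<subseteq> X' \<Longrightarrow> bond V E X' X (\<Phi> X') = \<Phi> X"
  using limit by (auto simp: inverse_limit_def)

lemma osep_of_in_oseps_iff:
  assumes "\<D> \<subseteq> comps V E X"
  shows "osep_of V E X \<D> \<in> oseps \<longleftrightarrow> X \<in> finsubs V \<and> \<D> \<in> \<Phi> X \<inter> unsplit_sets V E X"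
proof
  assume "osep_of V E X \<D> \<in> oseps"
  then obtain X' \<D>' where eq: "osep_of V E X \<D> = osep_of V E X' \<D>'" and X': "X' \<in> finsubs V"
    "\<D>' \<in> \<Phi> X' \<inter> unsplit_sets V E X'"
    unfolding oseps_def by blast
  have "X = X' \<and> \<D> = \<D>'" by (rule osep_of_inj[OF assms unsplit_sets_subset eq]) (use X' in blast)
  then show "X \<in> finsubs V \<and> \<D> \<in> \<Phi> X \<inter> unsplit_sets V E X" using X' by simp
qed (auto simp: oseps_def)

lemma oseps_finite_order: "r \<in> oseps \<Longrightarrow> fst r \<inter> snd r \<in> finsubs V"
  using osep_of_Int[OF unsplit_sets_subset] by (fastforce simp: oseps_def)

text \<open>Lifting to \<open>Z\<close> stays in the limit point by \<open>bond_lift\<close>, which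
  lets separations with different separators be compared at one common \<open>Z\<close>.\<close>

lemma oseps_above:
  assumes r: "r \<in> oseps" and Z: "fst r \<inter> snd r \<subseteq> Z" "Z \<in> finsubs V"
  shows "\<exists>\<D>\<in>\<Phi> Z. \<Union>\<D> \<subseteq> snd r"
proof -
  obtain X \<D> where X: "r = osep_of V E X \<D>" "X \<in> finsubs V" "\<D> \<in> \<Phi> X" "\<D> \<in> unsplit_sets V E X"
    using r by (auto simp: oseps_def)
  have sub: "\<D> \<subseteq> comps V E X" using X(4) by (rule unsplit_sets_subset)
  have XZ: "X \<subseteq> Z" using Z(1) osep_of_Int[OF sub] X(1) by simp
  have "lift_comps V E Z \<D> \<in> \<Phi> Z"
    using bond_lift[OF XZ filters[OF Z(2)] _ sub] bond[OF X(2) Z(2) XZ] X(3) by simp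
  moreover have "\<Union>(lift_comps V E Z \<D>) \<subseteq> snd r"
    unfolding Union_lift_comps[OF XZ sub] X(1) by (auto simp: osep_of_def)
  ultimately show ?thesis by blast
qed

lemma infinite_Inter_big_sides:
  assumes \<sigma>: "\<sigma> \<subseteq> oseps" "finite \<sigma>" "\<sigma> \<noteq> {}"
  shows "infinite (\<Inter>r\<in>\<sigma>. snd r)"
proof
  assume fin: "finite (\<Inter>r\<in>\<sigma>. snd r)"
  \<comment> \<open>\<open>Z\<close> contains all separators, so every \<open>r\<close> can be
    compared at \<open>Z\<close>. It also absorbs the supposedly finite intersection, leaving no
    room for a component of \<open>G - Z\<close> inside all big sides.\<close>
  define Z where "Z = V \<inter> (\<Inter>r\<in>\<sigma>. snd r) \<union> (\<Union>r\<in>\<sigma>. fst r \<inter> snd r)"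
  have Z: "Z \<in> finsubs V"
    using fin \<sigma> oseps_finite_order by (fastforce simp: Z_def finsubs_def)
  have big: "\<exists>\<D>\<in>\<Phi> Z. \<forall>r\<in>\<rho>. \<Union>\<D> \<subseteq> snd r" if "finite \<rho>" "\<rho> \<noteq> {}" "\<rho> \<subseteq> \<sigma>" for \<rho>
    using that
  proof (induction rule: finite_ne_induct)
    case (singleton r)
    then show ?case using oseps_above[OF _ _ Z, of r] \<sigma>(1) by (auto simp: Z_def)
  next
    case (insert r \<rho>)
    then obtain \<D> where D: "\<D> \<in> \<Phi> Z" "\<forall>r\<in>\<rho>. \<Union>\<D> \<subseteq> snd r" by blast
    moreover obtain \<C> where "\<C> \<in> \<Phi> Z" "\<Union>\<C> \<subseteq> snd r"
      using oseps_above[OF _ _ Z, of r] insert.prems \<sigma>(1) by (auto simp: Z_def)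
    ultimately show ?case using filters_at_Int[OF filters[OF Z], of \<C> \<D>]
      by (intro bexI[of _ "\<C> \<inter> \<D>"]) blast+
  qed
  obtain \<D> where D: "\<D> \<in> \<Phi> Z" "\<forall>r\<in>\<sigma>. \<Union>\<D> \<subseteq> snd r" using big[OF \<sigma>(2,3)] by blast
  have "\<D> \<noteq> {}" using D(1) filters_at_empty[OF filters[OF Z]] by auto
  then obtain C where C: "C \<in> \<D>" by blast
  then have CC: "C \<in> comps V E Z" using filters_at_subset[OF filters[OF Z] D(1)] by blast
  have "C \<subseteq> (\<Inter>r\<in>\<sigma>. snd r)" using C D(2) by blast
  then have "C \<subseteq> Z" using comps_subset[OF CC] by (auto simp: Z_def)
  then show False using comps_subset[OF CC] comps_nonempty[OF CC] by blast
qed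

lemma oseps_tangle: "aleph0_tangle (crit_seps V E) oseps"
proof -
  have "\<exists>!r. r \<in> oseps \<and> r \<in> orientations s" if s: "s \<in> crit_seps V E" for s
  proof -
    obtain X \<D> where X: "X \<in> finsubs V" "\<D> \<in> unsplit_sets V E X"
      "s = {fst (osep_of V E X \<D>), snd (osep_of V E X \<D>)}"
      using crit_seps_osep_of[OF s] .
    have sub: "\<D> \<subseteq> comps V E X" using X(2) by (rule unsplit_sets_subset)
    have or: "orientations s = {osep_of V E X \<D>, osep_of V E X (comps V E X - \<D>)}"
      using X(3) orientations_osep_of[OF sub] by simp
    have "osep_of V E X \<D> \<in> oseps \<longleftrightarrow> \<D> \<in> \<Phi> X"
      using osep_of_in_oseps_iff[OF sub] X by blast
    moreover have "osep_of V E X (comps V E X - \<D>) \<in> oseps \<longleftrightarrow> \<D> \<notin> \<Phi> X"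
      using osep_of_in_oseps_iff[OF Diff_subset] X unsplit_sets_compl[OF X(2)]
        filters_at_compl_iff[OF filters[OF X(1)] X(2)] by blast
    ultimately show ?thesis unfolding or by blast
  qed
  then have "orientation_of (crit_seps V E) oseps"
    unfolding orientation_of_def orientations_crit_seps by (auto simp: oseps_def)
  moreover have "consistent oseps"
    unfolding consistent_def
  proof
    assume "\<exists>r\<in>oseps. \<exists>s\<in>oseps. r \<noteq> s \<and> osep_less (prod.swap r) s"
    then obtain r s where rs: "r \<in> oseps" "s \<in> oseps" "snd r \<subseteq> fst s"
      by (auto simp: osep_less_def osep_le_def)
    \<comment> \<open>Two separations pointing apart would have big sides that meet only inside the
      finite separator of \<open>s\<close>.\<close>
    have "infinite (snd r \<inter> snd s)" using infinite_Inter_big_sides[of "{r, s}"] rs by simp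
    moreover have "snd r \<inter> snd s \<subseteq> fst s \<inter> snd s" using rs by blast
    moreover have "finite (fst s \<inter> snd s)" using oseps_finite_order[OF rs(2)] by (simp add: finsubs_def)
    ultimately show False using finite_subset by blast
  qed
  ultimately show ?thesis
    using infinite_Inter_big_sides by (auto simp: aleph0_tangle_def star_def star_interior_def)
qed

lemma tangle_filter_oseps:
  assumes "X \<in> finsubs V"
  shows "tangle_filter V E oseps X = \<Phi> X"
proof -
  have "tangle_sets V E oseps X = \<Phi> X \<inter> unsplit_sets V E X"
    using osep_of_in_oseps_iff[of _ X] unsplit_sets_subset assms
    by (fastforce simp: tangle_sets_osep_of)
  then show ?thesis
    using filters_at_unsplit_base[OF filters[OF assms]] by (simp add: tangle_filter_def)
qed

end

section \<open>Injectivity and surjectivity of the map to the inverse limit\<close>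

theorem theorem5p6p4:
  fixes V :: "'a set" and E :: "'a set set"
  assumes "simple_graph V E"
  shows "bij_betw (\<lambda>\<tau>. \<lambda>X\<in>finsubs V. tangle_filter V E \<tau> X)
    {\<tau>. aleph0_tangle (crit_seps V E) \<tau>} (inverse_limit V E)"
  unfolding bij_betw_def
proof (intro conjI inj_onI)
  fix \<tau> \<tau>' assume "\<tau> \<in> {\<tau>. aleph0_tangle (crit_seps V E) \<tau>}" "\<tau>' \<in> {\<tau>. aleph0_tangle (crit_seps V E) \<tau>}"
    and eq: "(\<lambda>X\<in>finsubs V. tangle_filter V E \<tau> X) = (\<lambda>X\<in>finsubs V. tangle_filter V E \<tau>' X)"
  then interpret t: crit_tangle V E \<tau> + t': crit_tangle V E \<tau>'
    by unfold_locales simp_all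
  have "tangle_filter V E \<tau> X = tangle_filter V E \<tau>' X" if "X \<in> finsubs V" for X
    using fun_cong[OF eq, of X] that by simp
  then show "\<tau> = \<tau>'" by (subst t.tangle_eq_oseps, subst t'.tangle_eq_oseps) blast
next
  show "(\<lambda>\<tau>. \<lambda>X\<in>finsubs V. tangle_filter V E \<tau> X) ` {\<tau>. aleph0_tangle (crit_seps V E) \<tau>} =
    inverse_limit V E" (is "?F ` ?T = _")
  proof (intro equalityI subsetI)
    show "\<Phi> \<in> inverse_limit V E" if "\<Phi> \<in> ?F ` ?T" for \<Phi>
      using that crit_tangle.tangle_filter_in_inverse_limit[OF crit_tangle.intro] by blast
  next
    fix \<Phi> assume \<Phi>: "\<Phi> \<in> inverse_limit V E"
    then interpret limit_point V E \<Phi> by unfold_locales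
    \<comment> \<open>Outside \<open>finsubs V\<close> both functions are \<open>undefined\<close>,
      so agreement at the finite sets suffices.\<close>
    have "\<Phi> \<in> extensional (finsubs V)" using \<Phi> by (auto simp: inverse_limit_def PiE_def)
    then have "?F oseps = \<Phi>"
      using tangle_filter_oseps by (intro extensionalityI[of _ "finsubs V"]) auto
    then show "\<Phi> \<in> ?F ` ?T" using oseps_tangle by (intro image_eqI[of _ _ oseps]) simp_all
  qed
qed

end
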